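(* Assume one of the following two cases. Case 1: $\mathsf f:[1,\infty)\to(0,\infty)$ is strictly increasing and smoothly varying with $\operatorname{Ind}\mathsf f\in(\frac12,1)$. Set $\mathsf g(x)=x/\mathsf f^{-1}(x)$ for $x\in[\mathsf f(1),\infty)$. Case 2: $\mathsf f(r)=r^{1/2}\int_1^rv(s)\,ds$ for $r\ge1$, where $v$ is smoothly varying with index $-1$ and $\int_1^\infty v(s)\,ds=\infty$. Set $\mathsf h(r)=\int_1^rs^{1/2}v(s)\,ds$ and $\mathsf g(x)=x/\mathsf h^{-1}(x)$ for $x\in[1,\infty)$. In both cases there exists $\hat x>0$ such that $\mathsf g$ is strictly decreasing on $[\hat x,\infty)$. Let $b=\mathsf g(\hat x)$, let $\varphi(t)=\mathsf g^{-1}(t)$ for $t\in(0,b]$ (the inverse of $\mathsf g|_{[\hat x,\infty)}$), and let $H(t)=\xi_{\varphi(t)}\xi_{\varphi(t)}^T$. Then, for large $r$, \[ \log\Bigl(\max_{|z|=r}\|W_H(b;z)\|\Bigr)\asymp\log|w_{H,22}(b;ir)|\asymp\mathsf f(r). \]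
   Context: Smooth variation: a positive $C^\infty$ function $f$ on $[1,\infty)$ is smoothly varying with index $\alpha$ if $h(x)=\log f(e^x)$ satisfies $h'(x)\to\alpha$ and $h^{(n)}(x)\to0$ for all $n\ge2$ as $x\to\infty$. $\operatorname{Ind}$ denotes the index. Notation: $\xi_\phi=(\cos\phi,\sin\phi)^T$. With $J=\begin{pmatrix}0&-1\\1&0\end{pmatrix}$, the fundamental solution $W_H(t;z)=(w_{H,ij}(t;z))$ of the Hamiltonian $H$ on $(0,b]$ solves $\partial_tW_H(t;z)J=zW_H(t;z)H(t)$ with $W_H(0;z)=I$. $W_H(b;\cdot)$ is the monodromy matrix. Asymptotic notation: $f\asymp g$ means $C_1g\le f\le C_2g$ for constants $C_1,C_2>0$. *)

theory Defs
  imports "HOL-Analysis.Analysis"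
begin

definition smoothly_varying :: "(real \<Rightarrow> real) \<Rightarrow> real \<Rightarrow> bool" where
  "smoothly_varying f \<alpha> \<longleftrightarrow>
     (\<forall>x\<ge>1. f x > 0) \<and>
     (\<exists>D :: nat \<Rightarrow> real \<Rightarrow> real.
        (\<forall>x\<ge>0. D 0 x = ln (f (exp x))) \<and>
        (\<forall>n. \<forall>x\<ge>0. (D n has_real_derivative D (Suc n) x) (at x within {0..})) \<and>
        (D 1 \<longlongrightarrow> \<alpha>) at_top \<and>
        (\<forall>n\<ge>2. (D n \<longlongrightarrow> 0) at_top))"

definition Jmat :: "complex^2^2" where
  "Jmat = (\<chi> i j. if i = 1 \<and> j = 2 then -1 else if i = 2 \<and> j = 1 then 1 else 0)"

definition xi :: "real \<Rightarrow> 2 \<Rightarrow> real" where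
  "xi \<phi> i = (if i = 1 then cos \<phi> else sin \<phi>)"

definition Hmat :: "(real \<Rightarrow> real) \<Rightarrow> real \<Rightarrow> complex^2^2" where
  "Hmat \<phi> t = (\<chi> i j. complex_of_real (xi (\<phi> t) i * xi (\<phi> t) j))"

text \<open>W z is the fundamental solution W_H(.;z) on [0,b]: d/dt (W J) = z W H, W(0) = I,
  in integrated (absolutely continuous) form.\<close>
definition fundamental_solution ::
    "(real \<Rightarrow> complex^2^2) \<Rightarrow> real \<Rightarrow> (complex \<Rightarrow> real \<Rightarrow> complex^2^2) \<Rightarrow> bool" where
  "fundamental_solution H b W \<longleftrightarrow>
     (\<forall>z. \<forall>t\<in>{0..b}.
        (\<lambda>s. W z s ** H s) integrable_on {0..t} \<and>
        W z t ** Jmat = Jmat + integral {0..t} (\<lambda>s. mat z ** (W z s ** H s)))"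

definition asymp_comparable :: "(real \<Rightarrow> real) \<Rightarrow> (real \<Rightarrow> real) \<Rightarrow> bool" where
  "asymp_comparable F G \<longleftrightarrow>
     (\<exists>C1 C2. C1 > 0 \<and> C2 > 0 \<and> (\<forall>\<^sub>F r in at_top. C1 * G r \<le> F r \<and> F r \<le> C2 * G r))"

end

theory Submission
  imports Defs
begin

text \<open>
  Let \<open>k\<close> be the function whose inverse enters \<open>g\<close>, that is \<open>k = f\<close> in the first case and
  \<open>k r = \<integral>\<^sub>1\<^sup>r s\<^sup>1\<^sup>/\<^sup>2 v(s) ds\<close> in the second.  With \<open>s\<close> as independent variable, the angle is \<open>k s\<close> and the
  time is \<open>k s / s\<close>, so that no inverse function has to be differentiated.  In the rotating frame a
  row of the fundamental solution solves \<open>a' = k' c\<close>, \<open>c' = - (k' + z p) a\<close> with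
  \<open>p = - (k s / s)'\<close>, which is comparable to \<open>k' / s\<close> for large \<open>s\<close>.

  For \<open>s \<ge> r\<close> the energy \<open>|a|\<^sup>2 + |c|\<^sup>2\<close> grows at most by the factor \<open>exp (k r)\<close>, and for \<open>s \<le> r\<close>
  the energy with weight \<open>w = (r / s)\<^sup>1\<^sup>/\<^sup>2\<close> grows at a rate of order \<open>w k'\<close>.  Both exponents are
  bounded by a multiple of \<open>f r\<close>, because \<open>f r\<close> is comparable to \<open>r\<^sup>1\<^sup>/\<^sup>2 V r\<close> where \<open>V' = k' / s\<^sup>1\<^sup>/\<^sup>2\<close>.
  For \<open>z = \<i> r\<close> the quantity \<open>P = Im (c a\<^sup>*)\<close> is nonnegative, and this makes a modified weighted
  energy grow at a rate bounded below by a multiple of \<open>w k'\<close>.  Finally \<open>|w\<^sub>2\<^sub>2|\<close> is monotone in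
  time, and it catches up with the norm of its row on any interval where the angle stays away
  from the zeros of the cosine.
\<close>

section \<open>Angle and time as functions of the parameter \<open>s\<close>\<close>

text \<open>Cauchy-Schwarz bounds the left side by \<open>2 |z| sqrt (X Y)\<close>, and the
  arithmetic-geometric mean inequality does the rest. It is applied with \<open>X = w * na\<close>
  and \<open>Y = nc / w\<close>, whose product does not depend on the weight \<open>w\<close>, so
  that the weight can be chosen freely.\<close>

lemma abs_lincomb_le_weighted_sum:
  fixes X Y P Q zr zi :: real
  assumes "X \<ge> 0" "Y \<ge> 0" "P\<^sup>2 + Q\<^sup>2 = X * Y"
  shows "2 * \<bar>zr * Q + zi * P\<bar> \<le> sqrt (zr\<^sup>2 + zi\<^sup>2) * (X + Y)"
proof (rule power2_le_imp_le)
  have "(zr * Q + zi * P)\<^sup>2 \<le> (zr\<^sup>2 + zi\<^sup>2) * (X * Y)"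
    using zero_le_power2[of "zr * P - zi * Q"] unfolding assms(3)[symmetric]
    by (simp add: power2_eq_square algebra_simps)
  moreover have "(zr\<^sup>2 + zi\<^sup>2) * (4 * (X * Y)) \<le> (zr\<^sup>2 + zi\<^sup>2) * (X + Y)\<^sup>2"
    using zero_le_power2[of "X - Y"]
    by (intro mult_left_mono) (auto simp: power2_eq_square algebra_simps)
  ultimately show "(2 * \<bar>zr * Q + zi * P\<bar>)\<^sup>2 \<le> (sqrt (zr\<^sup>2 + zi\<^sup>2) * (X + Y))\<^sup>2"
    by (simp add: power_mult_distrib)
qed (use assms in auto)

text \<open>By \<open>k'_le\<close> the time \<open>k s / s\<close> is nonincreasing:
  \<open>s\<close> at infinity corresponds to time 0 and \<open>s = S\<close> to the right end
  \<open>b\<close>. At \<open>S\<close> itself only continuity is asked, since \<open>S\<close> may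
  be 1, where the domain of the given functions ends.\<close>

locale phase =
  fixes k k' V :: "real \<Rightarrow> real" and S :: real
  assumes S_ge: "1 \<le> S"
    and k_cont: "continuous_on {S..} k"
    and k_deriv: "\<And>s. s > S \<Longrightarrow> (k has_real_derivative k' s) (at s)"
    and V_cont: "continuous_on {S..} V"
    and V_deriv: "\<And>s. s > S \<Longrightarrow> (V has_real_derivative k' s / sqrt s) (at s)"
    and k'_nonneg: "\<And>s. s > S \<Longrightarrow> 0 \<le> k' s"
    and k_nonneg: "\<And>s. s \<ge> S \<Longrightarrow> 0 \<le> k s"
    and k'_le: "\<And>s. s > S \<Longrightarrow> s * k' s \<le> k s"
    and k_over_tendsto: "((\<lambda>s. k s / s) \<longlongrightarrow> 0) at_top"
begin

definition p :: "real \<Rightarrow> real" where "p s = k s / s\<^sup>2 - k' s / s"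

lemma p_nonneg: "s > S \<Longrightarrow> 0 \<le> p s"
  using k'_le[of s] S_ge by (simp add: p_def field_simps power2_eq_square)

definition tm :: "real \<Rightarrow> real" where "tm s = k s / s"

lemma tm_deriv: "s > S \<Longrightarrow> (tm has_real_derivative - p s) (at s)"
  unfolding tm_def[abs_def] using S_ge
  by (auto intro!: derivative_eq_intros k_deriv simp: p_def field_simps power2_eq_square)

lemma tm_cont: "continuous_on {S..} tm"
  unfolding tm_def[abs_def] using S_ge by (intro continuous_intros k_cont) auto

lemma tm_tendsto: "(tm \<longlongrightarrow> 0) at_top"
  using k_over_tendsto by (simp add: tm_def[abs_def])

end

section \<open>Upper bounds for the energy of a row\<close>

text \<open>A row \<open>y\<close> of the fundamental solution at time \<open>k s / s\<close> is written in the rotating frame as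
  \<open>y = a \<xi> + c \<xi>'\<close> with \<open>\<xi>, \<xi>'\<close> the unit vectors at angles \<open>k s\<close> and \<open>k s + \<pi>/2\<close>; then
  \<open>na\<close>, \<open>nc\<close> are \<open>|a|\<^sup>2\<close>, \<open>|c|\<^sup>2\<close>, and \<open>P\<close>, \<open>Q\<close> are the imaginary and the real part of
  \<open>c\<close> times the conjugate of \<open>a\<close>.  The spectral parameter is \<open>zr + \<i> zi\<close>.\<close>
locale frame = phase +
  fixes na nc P Q :: "real \<Rightarrow> real" and zr zi :: real
  assumes na_cont: "continuous_on {S..} na"
    and nc_cont: "continuous_on {S..} nc"
    and P_cont: "continuous_on {S..} P"
    and Q_cont: "continuous_on {S..} Q"
    and na_deriv: "\<And>s. s > S \<Longrightarrow> (na has_real_derivative 2 * k' s * Q s) (at s)"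
    and nc_deriv: "\<And>s. s > S \<Longrightarrow>
      (nc has_real_derivative - 2 * k' s * Q s - 2 * p s * (zr * Q s + zi * P s)) (at s)"
    and P_deriv: "\<And>s. s > S \<Longrightarrow> (P has_real_derivative - p s * zi * na s) (at s)"
    and Q_deriv: "\<And>s. s > S \<Longrightarrow>
      (Q has_real_derivative k' s * (nc s - na s) - p s * zr * na s) (at s)"
    and na_nonneg: "\<And>s. na s \<ge> 0"
    and nc_nonneg: "\<And>s. nc s \<ge> 0"
    and PQ: "\<And>s. (P s)\<^sup>2 + (Q s)\<^sup>2 = na s * nc s"
    and energy_tendsto: "((\<lambda>s. na s + nc s) \<longlongrightarrow> 1) at_top"
begin

lemma PQ_weighted:
  assumes "w > 0"
  shows "2 * \<bar>x * Q s + y * P s\<bar> \<le> sqrt (x\<^sup>2 + y\<^sup>2) * (w * na s + nc s / w)"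
  using assms by (intro abs_lincomb_le_weighted_sum) (auto simp: na_nonneg nc_nonneg PQ)

lemma PQ_weighted':
  assumes "w > 0"
  shows "2 * (x * Q s + y * P s) \<le> sqrt (x\<^sup>2 + y\<^sup>2) * (w * na s + nc s / w)"
  by (rule order_trans[OF _ PQ_weighted[OF assms]]) (intro mult_left_mono abs_ge_self, simp)

text \<open>In the unweighted energy the rotation terms \<open>2 k' Q\<close> cancel, and the
  derivative is at least \<open>- |z| p (na + nc)\<close>. Since \<open>p = - tm'\<close>, the
  product of the energy with \<open>exp (- |z| tm)\<close> is nondecreasing, and its limit is 1. At
  \<open>s = |z|\<close> the exponent becomes \<open>k |z|\<close>.\<close>

lemma energy_tail:
  assumes "s \<ge> S"
  shows "na s + nc s \<le> exp (sqrt (zr\<^sup>2 + zi\<^sup>2) * tm s)"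
proof -
  define r where "r = sqrt (zr\<^sup>2 + zi\<^sup>2)"
  define u where "u = (\<lambda>s. (na s + nc s) * exp (- r * tm s))"
  have mono: "u s \<le> u s'" if "s' \<ge> s" for s'
  proof (rule DERIV_nonneg_imp_increasing_open[OF that])
    fix x assume x: "s < x" "x < s'"
    then have xS: "x > S" using assms by simp
    have "(u has_real_derivative
        (r * p x * (na x + nc x) - 2 * p x * (zr * Q x + zi * P x)) * exp (- r * tm x)) (at x)"
      unfolding u_def
      by (auto intro!: derivative_eq_intros na_deriv[OF xS] nc_deriv[OF xS] tm_deriv[OF xS]
          simp: algebra_simps)
    moreover have "p x * (2 * (zr * Q x + zi * P x)) \<le> p x * (r * (na x + nc x))"
      using PQ_weighted'[of 1 zr x zi] p_nonneg[OF xS] unfolding r_def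
      by (intro mult_left_mono) simp_all
    then have "0 \<le> r * p x * (na x + nc x) - 2 * p x * (zr * Q x + zi * P x)"
      by (simp add: algebra_simps)
    ultimately show "\<exists>y. (u has_real_derivative y) (at x) \<and> 0 \<le> y"
      by (meson exp_ge_zero mult_nonneg_nonneg)
  next
    show "continuous_on {s..s'} u" unfolding u_def
      by (rule continuous_on_subset[of "{S..}"])
        (use assms in \<open>auto intro!: continuous_intros na_cont nc_cont tm_cont\<close>)
  qed
  have "(u \<longlongrightarrow> 1 * exp (- r * 0)) at_top"
    unfolding u_def by (intro tendsto_intros energy_tendsto tm_tendsto)
  then have "u s \<le> 1"
    by (intro tendsto_lowerbound[of u 1 at_top]) (auto simp: eventually_at_top_linorder intro: mono)
  then show ?thesis by (simp add: u_def r_def tm_def exp_minus field_simps)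
qed

text \<open>The weight \<open>w = sqrt (r / s)\<close> balances the two sources of growth: when
  \<open>p\<close> is of order \<open>k' / s\<close>, the rate \<open>k' w\<close> of the rotation
  and the rate \<open>r p / w\<close> of the spectral parameter have the same order.\<close>

lemma energy_upper:
  defines "r \<equiv> sqrt (zr\<^sup>2 + zi\<^sup>2)"
  assumes r: "r \<ge> S"
  shows "na S + nc S \<le> r * exp (k r + 2 * sqrt r * V r + sqrt r * (2 * k S - 2 * V S))"
proof -
  have r1: "r \<ge> 1" using r S_ge by simp
  define w where "w = (\<lambda>s. sqrt (r / s))"
  define E where "E = (\<lambda>s. w s * na s + nc s / w s)"
  \<comment> \<open>\<open>G\<close> is a primitive of the growth rate
    \<open>1 / (2 s) + k' w + r p / w\<close>, whose first term accounts for \<open>w'\<close>. For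
    the last term, \<open>p * sqrt s = k / s^(3/2) - k' / sqrt s\<close> is the derivative of
    \<open>- 2 k / sqrt s\<close> plus \<open>k' / sqrt s\<close>, that is, plus
    \<open>V'\<close>.\<close>
  define G where "G = (\<lambda>s. ln s / 2 + sqrt r * (2 * V s - 2 * k s / sqrt s))"
  define u where "u = (\<lambda>s. E s * exp (G s))"
  have u_le: "u S \<le> u r"
  proof (rule DERIV_nonneg_imp_increasing_open[OF r])
    fix x assume x: "S < x" "x < r"
    have x0: "x > 0" using x S_ge by simp
    have wx: "w x > 1" using x x0 by (simp add: w_def)
    have w2: "w x * w x = r / x" "r / w x = sqrt r * sqrt x"
      using x0 r1 by (auto simp: w_def real_sqrt_divide field_simps)
    have dw: "(w has_real_derivative - w x / (2 * x)) (at x)"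
      unfolding w_def using x0 r1
      by (auto intro!: derivative_eq_intros simp: real_sqrt_divide field_simps power2_eq_square)
    have dG: "(G has_real_derivative 1 / (2 * x) + k' x * w x + p x * (r / w x)) (at x)"
    proof -
      have "(G has_real_derivative 1 / (2 * x) + sqrt r * (2 * (k' x / sqrt x)
          - (2 * k' x * sqrt x - 2 * k x * (inverse (sqrt x) / 2)) / (sqrt x)\<^sup>2)) (at x)"
        unfolding G_def using x0 x
        by (auto intro!: derivative_eq_intros V_deriv k_deriv simp: power2_eq_square mult_ac)
      moreover have "sqrt r * (2 * (k' x / sqrt x)
          - (2 * k' x * sqrt x - 2 * k x * (inverse (sqrt x) / 2)) / (sqrt x)\<^sup>2)
          = k' x * w x + p x * (r / w x)"
      proof -
        define q where "q = sqrt x"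
        have q: "q > 0" "x = q * q" using x0 by (auto simp: q_def)
        show ?thesis unfolding w2(2) p_def unfolding w_def real_sqrt_divide q_def[symmetric]
          using q by (simp add: q(2) field_simps power2_eq_square)
      qed
      ultimately show ?thesis by (simp add: add.assoc)
    qed
    have Ex: "E x \<ge> 0" using wx by (simp add: E_def na_nonneg nc_nonneg)
    define E' where "E' = - (w x * na x - nc x / w x) / (2 * x) + k' x * (w x - 1 / w x) * (2 * Q x)
        - p x / w x * (2 * (zr * Q x + zi * P x))"
    have dE: "(E has_real_derivative E') (at x)"
    proof -
      have "(E has_real_derivative - w x / (2 * x) * na x + w x * (2 * k' x * Q x)
          + ((- 2 * k' x * Q x - 2 * p x * (zr * Q x + zi * P x)) * w x
             - nc x * (- w x / (2 * x))) / (w x * w x)) (at x)"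
        unfolding E_def using wx
        by (auto intro!: derivative_eq_intros dw na_deriv[OF x(1)] nc_deriv[OF x(1)])
      then show ?thesis
        by (rule DERIV_cong) (use wx x0 in \<open>simp add: E'_def field_simps\<close>)
    qed
    have e1: "(w x * na x - nc x / w x) / (2 * x) \<le> E x / (2 * x)"
      using x0 wx nc_nonneg[of x] by (intro divide_right_mono) (auto simp: E_def)
    have e2: "k' x * (w x - 1 / w x) * (2 * Q x) \<ge> - (k' x * w x * E x)"
    proof -
      define m where "m = k' x * (w x - 1 / w x)"
      have "1 / w x \<le> w x" by (rule order_trans[of _ 1]) (use wx in auto)
      then have m: "0 \<le> m" "m \<le> k' x * w x"
        using k'_nonneg[OF x(1)] wx by (auto simp: m_def intro!: mult_left_mono)
      have Q: "2 * \<bar>Q x\<bar> \<le> E x"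
        using PQ_weighted[of "w x" 1 x 0] wx by (simp add: E_def)
      have "m * (- (2 * Q x)) \<le> m * E x" using Q m by (intro mult_left_mono) auto
      also have "\<dots> \<le> k' x * w x * E x" using m Ex by (intro mult_right_mono) auto
      finally show ?thesis unfolding m_def[symmetric] by (simp del: mult_minus_left)
    qed
    have e3: "p x / w x * (2 * (zr * Q x + zi * P x)) \<le> p x / w x * (r * E x)"
      using PQ_weighted'[of "w x" zr x zi] wx p_nonneg[OF x(1)] unfolding E_def r_def
      by (intro mult_left_mono) simp_all
    have "E' + E x * (1 / (2 * x) + k' x * w x + p x * (r / w x)) \<ge> 0"
    proof -
      have "E' = - ((w x * na x - nc x / w x) / (2 * x)) + k' x * (w x - 1 / w x) * (2 * Q x)
          - p x / w x * (2 * (zr * Q x + zi * P x))"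
        unfolding E'_def by (simp only: minus_divide_left)
      moreover have "E x * (1 / (2 * x) + k' x * w x + p x * (r / w x))
          = E x / (2 * x) + k' x * w x * E x + p x / w x * (r * E x)"
        by (simp add: algebra_simps)
      ultimately show ?thesis using e1 e2 e3 by linarith
    qed
    moreover have "(u has_real_derivative
        (E' + E x * (1 / (2 * x) + k' x * w x + p x * (r / w x))) * exp (G x)) (at x)"
      unfolding u_def by (auto intro!: derivative_eq_intros dE dG simp: algebra_simps)
    ultimately show "\<exists>y. (u has_real_derivative y) (at x) \<and> 0 \<le> y"
      by (meson exp_ge_zero mult_nonneg_nonneg)
  next
    show "continuous_on {S..r} u" unfolding u_def E_def G_def w_def
      by (rule continuous_on_subset[of "{S..}"])
        (use S_ge r1 in \<open>auto intro!: continuous_intros na_cont nc_cont k_cont V_cont\<close>)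
  qed
  \<comment> \<open>At \<open>s = r\<close> the weight equals 1, so the weighted energy is the plain
    one and the tail estimate bounds it.\<close>
  have Er: "E r \<le> exp (k r)"
    using energy_tail[OF r] r1 by (simp add: E_def w_def tm_def r_def[symmetric])
  have "exp (G r) \<le> sqrt r * exp (2 * sqrt r * V r)"
  proof -
    have "exp (ln r / 2) = sqrt r" using r1 by (simp add: ln_sqrt[symmetric])
    moreover have "exp (sqrt r * (2 * V r - 2 * k r / sqrt r)) \<le> exp (2 * sqrt r * V r)"
      using k_nonneg[OF r] r1 by (simp add: algebra_simps)
    ultimately show ?thesis unfolding G_def exp_add
      using r1 by (simp add: mult_left_mono)
  qed
  then have "u r \<le> exp (k r) * (sqrt r * exp (2 * sqrt r * V r))"
    unfolding u_def using Er by (intro mult_mono) auto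
  \<comment> \<open>At \<open>S\<close> the weight lies between 1 and \<open>sqrt r\<close>, so
    removing it costs one factor \<open>sqrt r\<close>. The other half of the final factor
    \<open>r\<close> comes from \<open>ln s / 2\<close> in \<open>G\<close>.\<close>
  moreover have "u S \<ge> (na S + nc S) / sqrt r * exp (- (sqrt r * (2 * k S - 2 * V S)))"
  proof -
    have wS: "1 \<le> w S" "w S \<le> sqrt r" using r r1 S_ge
      by (auto simp: w_def divide_le_eq mult_le_cancel_left1)
    have "na S / sqrt r \<le> na S"
      using r1 na_nonneg[of S] by (simp add: divide_le_eq mult_le_cancel_left1)
    also have "\<dots> \<le> w S * na S"
      using wS(1) na_nonneg[of S] by (simp add: mult_le_cancel_right1)
    finally have "na S / sqrt r \<le> w S * na S" .
    moreover have "nc S / sqrt r \<le> nc S / w S"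
      using wS r1 nc_nonneg[of S] by (intro divide_left_mono mult_pos_pos) auto
    ultimately have 1: "(na S + nc S) / sqrt r \<le> E S" by (simp add: E_def add_divide_distrib)
    have "k S / sqrt S \<le> k S" using k_nonneg[of S] S_ge by (simp add: divide_le_eq mult_le_cancel_left1)
    then have "sqrt r * (2 * k S / sqrt S - 2 * V S) \<le> sqrt r * (2 * k S - 2 * V S)"
      using r1 by (intro mult_left_mono) auto
    then have 2: "- (sqrt r * (2 * k S - 2 * V S)) \<le> G S"
      using S_ge unfolding G_def by (auto simp: algebra_simps intro: add_increasing)
    show ?thesis unfolding u_def using 1 2 r1 na_nonneg[of S] nc_nonneg[of S]
      by (intro mult_mono) (use wS in \<open>auto simp: E_def intro!: add_nonneg_nonneg divide_nonneg_nonneg mult_nonneg_nonneg\<close>)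
  qed
  ultimately have "(na S + nc S) / sqrt r * exp (- (sqrt r * (2 * k S - 2 * V S)))
      \<le> exp (k r) * (sqrt r * exp (2 * sqrt r * V r))"
    using u_le by linarith
  then have "na S + nc S \<le> exp (k r) * (sqrt r * exp (2 * sqrt r * V r)) * sqrt r * exp (sqrt r * (2 * k S - 2 * V S))"
    using r1 unfolding exp_minus by (simp only: divide_inverse[symmetric]) (simp add: pos_divide_le_eq mult_ac)
  also have "\<dots> = (sqrt r * sqrt r) * exp (k r + 2 * sqrt r * V r + sqrt r * (2 * k S - 2 * V S))"
    by (simp only: exp_add mult_ac)
  finally show ?thesis using r1 by simp
qed

end

section \<open>Lower bounds on the imaginary axis\<close>

text \<open>\<open>B\<close> is the squared modulus of the second component of the row.\<close>
locale imaginary_frame = frame k k' V S na nc P Q 0 r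
  for k k' V S na nc P Q r +
  assumes r_nonneg: "r \<ge> 0"
    and P_tendsto: "(P \<longlongrightarrow> 0) at_top"
    and B_tendsto: "((\<lambda>s. na s * (sin (k s))\<^sup>2 + nc s * (cos (k s))\<^sup>2
          + 2 * Q s * sin (k s) * cos (k s)) \<longlongrightarrow> 1) at_top"
begin

definition B :: "real \<Rightarrow> real" where
  "B s = na s * (sin (k s))\<^sup>2 + nc s * (cos (k s))\<^sup>2 + 2 * Q s * sin (k s) * cos (k s)"

text \<open>The initial condition sits at \<open>s\<close> at infinity, that is at time 0, so lower
  bounds come from monotonicity together with a limit.\<close>

lemma ge_limit:
  fixes u :: "real \<Rightarrow> real"
  assumes deriv: "\<And>s. s > S \<Longrightarrow> \<exists>y. (u has_real_derivative y) (at s) \<and> y \<le> 0"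
    and cont: "continuous_on {S..} u" and lim: "(u \<longlongrightarrow> l) at_top" and s: "s \<ge> S"
  shows "u s \<ge> l"
proof (rule tendsto_upperbound[OF lim])
  have "u s' \<le> u s" if "s' \<ge> s" for s'
    by (rule DERIV_nonpos_imp_decreasing_open[OF that])
      (use s in \<open>auto intro: deriv continuous_on_subset[OF cont]\<close>)
  then show "\<forall>\<^sub>F s' in at_top. u s' \<le> u s"
    by (auto simp: eventually_at_top_linorder)
qed simp

lemma P_nonneg: "s \<ge> S \<Longrightarrow> 0 \<le> P s"
proof (rule ge_limit[OF _ P_cont P_tendsto])
  fix s assume "s > S"
  then show "\<exists>y. (P has_real_derivative y) (at s) \<and> y \<le> 0"
    using P_deriv[of s] p_nonneg[of s] na_nonneg[of s] r_nonneg by fastforce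
qed

lemma energy_deriv:
  "s > S \<Longrightarrow> ((\<lambda>s. na s + nc s) has_real_derivative - 2 * p s * r * P s) (at s)"
  by (auto intro!: derivative_eq_intros na_deriv nc_deriv)

lemma energy_deriv_nonpos:
  "s > S \<Longrightarrow> - 2 * p s * r * P s \<le> 0"
  using P_nonneg[of s] p_nonneg[of s] r_nonneg by simp

lemma energy_ge_1: "s \<ge> S \<Longrightarrow> 1 \<le> na s + nc s"
  by (rule ge_limit[OF _ _ energy_tendsto])
    (auto intro!: continuous_intros na_cont nc_cont exI energy_deriv energy_deriv_nonpos)

lemma energy_antimono:
  assumes "S \<le> s" "s \<le> s'"
  shows "na s' + nc s' \<le> na s + nc s"
proof (rule DERIV_nonpos_imp_decreasing_open[OF assms(2)])
  show "continuous_on {s..s'} (\<lambda>s. na s + nc s)"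
    by (rule continuous_on_subset[of "{S..}"])
      (use assms in \<open>auto intro!: continuous_intros na_cont nc_cont\<close>)
  show "\<exists>y. ((\<lambda>s. na s + nc s) has_real_derivative y) (at x) \<and> y \<le> 0" if "s < x" "x < s'" for x
    using that assms by (intro exI[of _ "- 2 * p x * r * P x"] conjI energy_deriv energy_deriv_nonpos) auto
qed

lemma B_cont: "continuous_on {S..} B"
  unfolding B_def[abs_def] by (intro continuous_intros na_cont nc_cont Q_cont k_cont)

text \<open>\<open>B\<close> refers to a fixed coordinate, so the rotation terms cancel. Compared
  with the derivative \<open>- 2 p r P\<close> of the whole energy, the second component receives
  the share \<open>cos^2\<close> of the growth.\<close>

lemma B_deriv: "s > S \<Longrightarrow> (B has_real_derivative - 2 * r * p s * (cos (k s))\<^sup>2 * P s) (at s)"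
  unfolding B_def[abs_def]
  by (auto intro!: derivative_eq_intros na_deriv nc_deriv Q_deriv k_deriv
      simp: power2_eq_square algebra_simps)

lemma B_deriv_nonpos: "s > S \<Longrightarrow> - 2 * r * p s * (cos (k s))\<^sup>2 * P s \<le> 0"
  using P_nonneg[of s] p_nonneg[of s] r_nonneg by simp

lemma B_ge_1: "s \<ge> S \<Longrightarrow> 1 \<le> B s"
proof (rule ge_limit[OF _ B_cont])
  show "(B \<longlongrightarrow> 1) at_top" using B_tendsto by (simp add: B_def[abs_def])
qed (use B_deriv B_deriv_nonpos in blast)+

lemma B_antimono:
  assumes "S \<le> s" "s \<le> s'"
  shows "B s' \<le> B s"
proof (rule DERIV_nonpos_imp_decreasing_open[OF assms(2)])
  show "continuous_on {s..s'} B"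
    by (rule continuous_on_subset[OF B_cont]) (use assms in auto)
  show "\<exists>y. (B has_real_derivative y) (at x) \<and> y \<le> 0" if "s < x" "x < s'" for x
    using that assms by (intro exI[of _ "- 2 * r * p x * (cos (k x))\<^sup>2 * P x"] conjI B_deriv B_deriv_nonpos) auto
qed

text \<open>The second component is \<open>y2 = a sin + c cos\<close>, hence \<open>c\<close> can be
  recovered from \<open>y2\<close> and \<open>a\<close> where the cosine is bounded away from 0:
  \<open>|c|^2 cos^2\<close> is at most \<open>2 |y2|^2 + 2 |a|^2\<close>. The first inequality of
  the proof absorbs the mixed term.\<close>

lemma energy_le_na_B:
  assumes "(cos (k s))\<^sup>2 \<ge> 1 / 4"
  shows "na s + nc s \<le> 9 * na s + 8 * B s"
proof -
  let ?s = "sin (k s)" and ?c = "cos (k s)"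
  have "2 * \<bar>1 * (2 * Q s * ?s * ?c) + 0 * (2 * P s * ?s * ?c)\<bar>
      \<le> sqrt (1\<^sup>2 + 0\<^sup>2) * (4 * na s * ?s\<^sup>2 + nc s * ?c\<^sup>2)"
  proof (rule abs_lincomb_le_weighted_sum)
    have "(2 * P s * ?s * ?c)\<^sup>2 + (2 * Q s * ?s * ?c)\<^sup>2 = ((P s)\<^sup>2 + (Q s)\<^sup>2) * (4 * ?s\<^sup>2 * ?c\<^sup>2)"
      by (simp add: power_mult_distrib algebra_simps)
    then show "(2 * P s * ?s * ?c)\<^sup>2 + (2 * Q s * ?s * ?c)\<^sup>2 = 4 * na s * ?s\<^sup>2 * (nc s * ?c\<^sup>2)"
      by (simp add: PQ)
  qed (simp_all add: na_nonneg nc_nonneg)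
  then have "- (4 * Q s * ?s * ?c) \<le> 4 * (na s * ?s\<^sup>2) + nc s * ?c\<^sup>2" by simp
  moreover have "na s * ?s\<^sup>2 \<le> na s"
    using na_nonneg[of s] by (simp add: mult_le_cancel_left2 power2_eq_square sin_squared_eq abs_square_le_1 abs_sin_le_one flip: power2_eq_square)
  ultimately have "nc s * ?c\<^sup>2 \<le> 2 * B s + 2 * na s" by (simp add: B_def)
  moreover have "nc s * (1 / 4) \<le> nc s * ?c\<^sup>2"
    using assms nc_nonneg by (intro mult_left_mono) auto
  ultimately show ?thesis by simp
qed

text \<open>Time runs forward from \<open>s1\<close> down to \<open>s2\<close>. If \<open>B\<close>
  stayed below a small fraction of the energy \<open>M\<close> at \<open>s1\<close>, the energy
  would sit in \<open>na\<close>. This drives \<open>P\<close> up linearly in time, at rate at least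
  \<open>r M / 16\<close>, and \<open>P\<close> in turn drives \<open>B\<close> up quadratically.
  After time \<open>1 / r\<close> the value of \<open>B\<close> is at least \<open>M / 64\<close>, a
  contradiction.\<close>

lemma B_ge_energy:
  assumes s: "S \<le> s2" "s2 \<le> s1"
    and cos: "\<And>s. s2 \<le> s \<Longrightarrow> s \<le> s1 \<Longrightarrow> (cos (k s))\<^sup>2 \<ge> 1 / 4"
    and r: "r * (tm s2 - tm s1) \<ge> 1"
  shows "B s2 \<ge> (na s1 + nc s1) / 128"
proof (rule ccontr)
  define M where "M = na s1 + nc s1"
  assume "\<not> ?thesis"
  then have small: "B s2 < M / 128" by (simp add: M_def)
  have M: "M \<ge> 1" using energy_ge_1 s by (auto simp: M_def)
  \<comment> \<open>\<open>M\<close> is at most \<open>9 na + 8 B\<close>, hence less than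
    \<open>9 na + M / 16\<close>; this gives \<open>na > 15 M / 144\<close>, more than
    \<open>M / 16\<close>.\<close>
  have na: "na s \<ge> M / 16" if "s2 \<le> s" "s \<le> s1" for s
  proof -
    have "M \<le> na s + nc s" using energy_antimono[of s s1] that s by (simp add: M_def)
    then show ?thesis using energy_le_na_B[OF cos[OF that]] B_antimono[OF s(1) that(1)] small M by linarith
  qed
  have P: "P s \<ge> r * M / 16 * (tm s - tm s1)" if "s2 \<le> s" "s \<le> s1" for s
  proof -
    have "P s1 - r * M / 16 * tm s1 \<le> P s - r * M / 16 * tm s"
    proof (rule DERIV_nonpos_imp_decreasing_open[OF that(2)])
      fix x assume x: "s < x" "x < s1"
      then have xS: "x > S" using that s by simp
      have "((\<lambda>s. P s - r * M / 16 * tm s) has_real_derivative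
          - p x * r * na x - r * M / 16 * (- p x)) (at x)"
        by (intro DERIV_diff DERIV_cmult P_deriv tm_deriv xS)
      moreover have "p x * r * (M / 16) \<le> p x * r * na x"
        using na[of x] x that p_nonneg[OF xS] r_nonneg by (intro mult_left_mono) auto
      ultimately show "\<exists>y. ((\<lambda>s. P s - r * M / 16 * tm s) has_real_derivative y) (at x) \<and> y \<le> 0"
        by (intro exI conjI) (auto simp: mult_ac)
    next
      show "continuous_on {s..s1} (\<lambda>s. P s - r * M / 16 * tm s)"
        by (rule continuous_on_subset[of "{S..}"])
          (use that s in \<open>auto intro!: continuous_intros P_cont tm_cont\<close>)
    qed
    then show ?thesis using P_nonneg[of s1] s by (simp add: algebra_simps)
  qed
  \<comment> \<open>In time \<open>B\<close> grows at rate \<open>2 r cos^2 P\<close>, which is at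
    least \<open>2 r * 1/4 * r M / 16\<close> times the elapsed time. The primitive of this is
    \<open>K\<close> times the square of the elapsed time.\<close>
  define K where "K = r\<^sup>2 * M / 64"
  have K0: "K \<ge> 0" using M by (simp add: K_def)
  have "B s1 - K * (tm s1 - tm s1)\<^sup>2 \<le> B s2 - K * (tm s2 - tm s1)\<^sup>2"
  proof (rule DERIV_nonpos_imp_decreasing_open[OF s(2)])
    fix x assume x: "s2 < x" "x < s1"
    then have xS: "x > S" using s by simp
    have "((\<lambda>s. B s - K * (tm s - tm s1)\<^sup>2) has_real_derivative
        - 2 * r * p x * (cos (k x))\<^sup>2 * P x + 2 * K * (tm x - tm s1) * p x) (at x)"
      by (auto intro!: derivative_eq_intros B_deriv tm_deriv xS)
    moreover have "2 * K * (tm x - tm s1) * p x \<le> 2 * r * p x * (cos (k x))\<^sup>2 * P x"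
    proof -
      have "2 * K * (tm x - tm s1) * p x = (2 * r * p x) * (1 / 4 * (r * M / 16 * (tm x - tm s1)))"
        by (simp add: K_def power2_eq_square)
      also have "\<dots> \<le> (2 * r * p x) * (1 / 4 * P x)"
        using P[of x] x p_nonneg[OF xS] r_nonneg by (intro mult_left_mono) auto
      also have "\<dots> \<le> (2 * r * p x) * ((cos (k x))\<^sup>2 * P x)"
        using cos[of x] x p_nonneg[OF xS] r_nonneg P_nonneg[of x] xS
        by (intro mult_left_mono mult_right_mono) auto
      finally show ?thesis by (simp add: mult_ac)
    qed
    ultimately show "\<exists>y. ((\<lambda>s. B s - K * (tm s - tm s1)\<^sup>2) has_real_derivative y) (at x) \<and> y \<le> 0"
      by (intro exI conjI) auto
  next
    show "continuous_on {s2..s1} (\<lambda>s. B s - K * (tm s - tm s1)\<^sup>2)"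
      by (rule continuous_on_subset[of "{S..}"])
        (use s in \<open>auto intro!: continuous_intros B_cont tm_cont\<close>)
  qed
  then have "K * (tm s2 - tm s1)\<^sup>2 \<le> B s2" using B_ge_1[of s1] s by simp
  moreover have "K * (tm s2 - tm s1)\<^sup>2 = (r * (tm s2 - tm s1))\<^sup>2 * (M / 64)"
    by (simp add: K_def power_mult_distrib)
  moreover have "1 * (M / 64) \<le> (r * (tm s2 - tm s1))\<^sup>2 * (M / 64)"
    using M r by (intro mult_right_mono) (auto simp: one_le_power)
  ultimately show False using small M by simp
qed

text \<open>The assumption on \<open>k\<close> gives \<open>p \<ge> \<theta> k' / s\<close>, that is
  \<open>p r \<ge> k' w^2\<close> for the weight \<open>w = sqrt (\<theta> r / s)\<close>. Hence the
  part \<open>- p r na - k' nc\<close> of the derivative of \<open>P - Q\<close> is at most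
  \<open>- k' w E\<close> and controls the whole weighted energy, whereas \<open>E'\<close> by
  itself contains the indefinite term \<open>2 k' w Q\<close>. The sign of \<open>P\<close> disposes
  of the spectral term in \<open>E'\<close>.\<close>

lemma energy_lower:
  fixes \<theta> :: real
  assumes \<theta>: "0 < \<theta>" "\<theta> \<le> 1" and s1: "S \<le> s1" "s1 \<le> \<theta> * r / 10"
    and k: "\<And>s. s > s1 \<Longrightarrow> (1 + \<theta>) * s * k' s \<le> k s"
  shows "na s1 + nc s1 \<ge> exp (sqrt (\<theta> * r) / 10 * (V (\<theta> * r / 10) - V s1)) / (40 * r ^ 3)"
proof -
  \<comment> \<open>Up to \<open>R\<close> the weight satisfies \<open>w^2 \<ge> 10\<close>. The
    terms carrying \<open>1 / w\<close>, of size at most \<open>5/2 * k' E / w\<close>, then cost at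
    most \<open>k' w E / 4\<close>.\<close>
  define R where "R = \<theta> * r / 10"
  have R: "s1 \<le> R" "R \<le> r" "1 \<le> R" "1 \<le> r" "1 \<le> s1"
  proof -
    have "\<theta> * r \<le> 1 * r" using \<theta> r_nonneg by (intro mult_right_mono) auto
    then show "R \<le> r" "s1 \<le> R" using s1 r_nonneg by (auto simp: R_def)
    show "1 \<le> s1" using s1 S_ge by simp
    then show "1 \<le> R" using s1 by (simp add: R_def)
    then show "1 \<le> r" using \<open>R \<le> r\<close> by simp
  qed
  define w where "w = (\<lambda>s. sqrt (\<theta> * r / s))"
  define E where "E = (\<lambda>s. w s * na s + nc s / w s)"
  \<comment> \<open>For large \<open>w\<close> the growing mode has \<open>P = - Q\<close>.  Any coefficient strictly between 1 and 2 would do: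
    below 2 it keeps \<open>L\<close> comparable to \<open>E\<close>, above 1 it beats the term \<open>2 w k' Q\<close> in \<open>E'\<close>.\<close>
  define L where "L = (\<lambda>s. E s + 3 / 2 * (P s - Q s))"
  \<comment> \<open>The decay found below is \<open>k' w E / 4\<close>. By
    \<open>L \<le> 5/2 * E\<close> it is at least \<open>k' w / 10 * L\<close>, and
    \<open>k' w / 10\<close> has the primitive \<open>sqrt (\<theta> r) / 10 * V\<close>. The term
    \<open>2 ln s\<close> absorbs \<open>E / (2 s)\<close>, which stems from \<open>w'\<close>,
    because \<open>L \<ge> E / 4\<close>.\<close>
  define G where "G = (\<lambda>s. sqrt (\<theta> * r) / 10 * V s - 2 * ln s)"
  define u where "u = (\<lambda>s. L s * exp (G s))"
  have w_pos: "w s > 0" if "s1 \<le> s" for s using that R \<theta> by (simp add: w_def)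
  have E_nonneg: "E s \<ge> 0" if "s1 \<le> s" for s
    using w_pos[OF that] by (simp add: E_def na_nonneg nc_nonneg)
  have Q_E: "2 * \<bar>Q s\<bar> \<le> E s" and P_E: "2 * \<bar>P s\<bar> \<le> E s" if "s1 \<le> s" for s
    using PQ_weighted[OF w_pos[OF that], of 1 s 0] PQ_weighted[OF w_pos[OF that], of 0 s 1]
    by (auto simp: E_def)
  have L_ge: "L s \<ge> E s / 4" if "s1 \<le> s" for s
    unfolding L_def using Q_E[OF that] P_nonneg[OF order_trans[OF s1(1) that]] E_nonneg[OF that] by (simp add: field_simps)
  have L_le: "L s \<le> 5 / 2 * E s" if "s1 \<le> s" for s
    unfolding L_def using Q_E[OF that] P_E[OF that] abs_ge_self[of "P s"] abs_ge_minus_self[of "Q s"] by (simp add: field_simps)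
  have "u R \<le> u s1"
  proof (rule DERIV_nonpos_imp_decreasing_open[OF R(1)])
    fix x assume x: "s1 < x" "x < R"
    have xS: "x > S" and x0: "x > 0" using x s1 R by auto
    have wx: "w x > 0" using w_pos x by simp
    have w2: "w x * w x = \<theta> * r / x" "(w x)\<^sup>2 \<ge> 10"
      using x0 \<theta> x R by (auto simp: w_def R_def field_simps)
    have dw: "(w has_real_derivative - w x / (2 * x)) (at x)"
      unfolding w_def using x0 \<theta> R
      by (auto intro!: derivative_eq_intros simp: real_sqrt_divide field_simps power2_eq_square)
    have dG: "(G has_real_derivative k' x * w x / 10 - 2 / x) (at x)"
      unfolding G_def w_def real_sqrt_divide using x0
      by (auto intro!: derivative_eq_intros V_deriv xS simp: field_simps)
    define L' where "L' = - (w x * na x - nc x / w x) / (2 * x) + k' x * (w x - 1 / w x) * (2 * Q x)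
        - p x / w x * (2 * (r * P x))
        + 3 / 2 * (- p x * r * na x - k' x * (nc x - na x))"
    have dL: "(L has_real_derivative L') (at x)"
    proof -
      have "(L has_real_derivative - w x / (2 * x) * na x + w x * (2 * k' x * Q x)
          + ((- 2 * k' x * Q x - 2 * p x * (0 * Q x + r * P x)) * w x
             - nc x * (- w x / (2 * x))) / (w x * w x)
          + 3 / 2 * (- p x * r * na x - (k' x * (nc x - na x) - p x * 0 * na x))) (at x)"
        unfolding L_def E_def using wx
        by (auto intro!: derivative_eq_intros dw na_deriv[OF xS] nc_deriv[OF xS] P_deriv[OF xS] Q_deriv[OF xS])
      then show ?thesis
        by (rule DERIV_cong) (use wx x0 in \<open>simp add: L'_def field_simps\<close>)
    qed
    define A C where "A = w x * na x" and "C = nc x / w x"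
    have AC: "A \<ge> 0" "C \<ge> 0" "E x = A + C"
      using wx by (auto simp: A_def C_def E_def na_nonneg nc_nonneg)
    have kx: "k' x \<ge> 0" using k'_nonneg[OF xS] .
    have pr: "p x * r \<ge> k' x * (w x)\<^sup>2"
    proof -
      have "\<theta> * k' x \<le> k x / x - k' x"
        using k[OF x(1)] x0 by (simp add: field_simps)
      then have "\<theta> * k' x / x * r \<le> (k x / x - k' x) / x * r"
        using x0 r_nonneg by (intro mult_right_mono divide_right_mono) auto
      then show ?thesis
        using x0 w2(1) by (simp add: p_def power2_eq_square diff_divide_distrib mult_ac)
    qed
    have e1: "- (A - C) / (2 * x) \<le> E x / (2 * x)"
      using x0 AC by (intro divide_right_mono) auto
    have e2: "p x * r * na x \<ge> k' x * w x * A"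
      using mult_right_mono[OF pr na_nonneg[of x]] by (simp add: A_def power2_eq_square mult_ac)
    have e3: "p x / w x * (2 * (r * P x)) \<ge> 0"
      using p_nonneg[OF xS] wx r_nonneg P_nonneg[of x] xS by simp
    have e4: "k' x * (w x * (2 * Q x)) \<le> k' x * (w x * E x)"
      using kx wx Q_E[of x] x by (intro mult_left_mono) auto
    have e5: "k' x / w x * (- 2 * Q x + 3 / 2 * A) \<le> k' x * w x * (E x / 4)"
    proof -
      have "- 2 * Q x + 3 / 2 * A \<le> 10 * (E x / 4)" using Q_E[of x] x AC by auto
      then have "k' x / w x * (- 2 * Q x + 3 / 2 * A) \<le> k' x / w x * (10 * (E x / 4))"
        using kx wx by (intro mult_left_mono) auto
      also have "\<dots> \<le> k' x / w x * ((w x)\<^sup>2 * (E x / 4))"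
        using kx wx w2 E_nonneg[of x] x by (intro mult_left_mono mult_right_mono) auto
      finally show ?thesis using wx by (simp add: power2_eq_square)
    qed
    have "L' = - (A - C) / (2 * x) + k' x * (w x * (2 * Q x)) - p x / w x * (2 * (r * P x))
        - 3 / 2 * (p x * r * na x) - 3 / 2 * (k' x * w x * C) + k' x / w x * (- 2 * Q x + 3 / 2 * A)"
      using wx unfolding L'_def A_def C_def by (simp add: field_simps)
    also have "\<dots> \<le> E x / (2 * x) + k' x * (w x * E x) - 0
        - 3 / 2 * (k' x * w x * A) - 3 / 2 * (k' x * w x * C) + k' x * w x * (E x / 4)"
      using e1 e2 e3 e4 e5 by linarith
    also have "\<dots> = E x / (2 * x) - k' x * w x * E x / 4"
      by (simp add: AC algebra_simps)
    finally have L': "L' \<le> E x / (2 * x) - k' x * w x * E x / 4" .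
    have "L' + L x * (k' x * w x / 10 - 2 / x) \<le> 0"
    proof -
      have "L x * (k' x * w x / 10) \<le> 5 / 2 * E x * (k' x * w x / 10)"
        using L_le[of x] x kx wx by (intro mult_right_mono) auto
      moreover have "E x / 4 * (2 / x) \<le> L x * (2 / x)"
        using L_ge[of x] x x0 by (intro mult_right_mono) auto
      ultimately show ?thesis using L' by (simp add: algebra_simps)
    qed
    moreover have "(u has_real_derivative (L' + L x * (k' x * w x / 10 - 2 / x)) * exp (G x)) (at x)"
      unfolding u_def by (auto intro!: derivative_eq_intros dL dG simp: algebra_simps)
    ultimately show "\<exists>y. (u has_real_derivative y) (at x) \<and> y \<le> 0"
      by (meson exp_ge_zero mult_nonpos_nonneg)
  next
    show "continuous_on {s1..R} u" unfolding u_def L_def E_def G_def w_def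
      by (rule continuous_on_subset[of "{s1..}"])
        (use \<theta> R s1 in \<open>auto intro!: continuous_intros continuous_on_subset[OF na_cont]
          continuous_on_subset[OF nc_cont] continuous_on_subset[OF P_cont]
          continuous_on_subset[OF Q_cont] continuous_on_subset[OF V_cont]\<close>)
  qed
  \<comment> \<open>At \<open>R\<close> the weight is \<open>sqrt 10 \<le> 4\<close>, so the lower
    bound 1 for the energy gives \<open>E R \<ge> 1/4\<close> and \<open>L R \<ge> 1/16\<close>. In
    the final denominator \<open>40 r^3\<close> the 40 is \<open>16 * 5/2\<close>, two powers of
    \<open>r\<close> bound \<open>exp (2 ln R)\<close>, and the third bounds the weight at
    \<open>s1\<close>.\<close>
  moreover have "1 / 16 * (exp (sqrt (\<theta> * r) / 10 * V R) / r\<^sup>2) \<le> u R"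
    unfolding u_def
  proof (intro mult_mono)
    have w: "w R = sqrt 10" using R \<theta> by (simp add: w_def R_def)
    have "sqrt 10 \<le> 4" "1 \<le> sqrt 10" by (auto intro: real_le_lsqrt)
    then have "na R \<le> sqrt 10 * na R" "nc R / 4 \<le> nc R / sqrt 10"
      using na_nonneg[of R] nc_nonneg[of R] mult_right_mono[of 1 "sqrt 10" "na R"]
      by (simp, intro divide_left_mono) auto
    then have "(na R + nc R) / 4 \<le> E R" using na_nonneg[of R] by (simp add: E_def w)
    then show "1 / 16 \<le> L R" using L_ge[OF R(1)] energy_ge_1[OF order_trans[OF s1(1) R(1)]] by (simp add: field_simps)
    have "exp (2 * ln R) = R\<^sup>2" using R by (simp add: exp_double)
    moreover have "R\<^sup>2 \<le> r\<^sup>2" using R by (intro power_mono) auto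
    ultimately show "exp (sqrt (\<theta> * r) / 10 * V R) / r\<^sup>2 \<le> exp (G R)"
      using R by (auto simp: G_def exp_diff intro!: divide_left_mono)
    show "0 \<le> L R" using \<open>1 / 16 \<le> L R\<close> by linarith
  qed simp
  moreover have "u s1 \<le> 5 / 2 * (r * (na s1 + nc s1)) * exp (sqrt (\<theta> * r) / 10 * V s1)"
    unfolding u_def
  proof (intro mult_mono)
    have "\<theta> * r / s1 \<le> 1 * r / 1" using \<theta> R by (intro frac_le mult_right_mono) auto
    then have w: "1 \<le> w s1" "w s1 \<le> r"
    proof -
      assume *: "\<theta> * r / s1 \<le> 1 * r / 1"
      show "1 \<le> w s1" using R s1 by (simp add: w_def)
      have "sqrt r \<le> r" using R by (intro real_le_lsqrt) (auto simp: power2_eq_square mult_le_cancel_left1)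
      moreover have "w s1 \<le> sqrt r" using * by (simp add: w_def)
      ultimately show "w s1 \<le> r" by (rule order_trans[rotated])
    qed
    have "w s1 * na s1 \<le> r * na s1" by (rule mult_right_mono) (use w na_nonneg in auto)
    moreover have "nc s1 / w s1 \<le> nc s1 / 1"
      by (rule divide_left_mono) (use w nc_nonneg[of s1] in auto)
    moreover have "1 * nc s1 \<le> r * nc s1" by (rule mult_right_mono) (use R nc_nonneg in auto)
    ultimately have "E s1 \<le> r * (na s1 + nc s1)" by (simp add: E_def algebra_simps)
    then show "L s1 \<le> 5 / 2 * (r * (na s1 + nc s1))" using L_le[of s1] by simp
    show "exp (G s1) \<le> exp (sqrt (\<theta> * r) / 10 * V s1)" using R by (simp add: G_def)
    show "0 \<le> 5 / 2 * (r * (na s1 + nc s1))" using na_nonneg nc_nonneg R by simp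
  qed simp
  ultimately have "1 / 16 * (exp (sqrt (\<theta> * r) / 10 * V R) / r\<^sup>2)
      \<le> 5 / 2 * (r * (na s1 + nc s1)) * exp (sqrt (\<theta> * r) / 10 * V s1)" by linarith
  then have "exp (sqrt (\<theta> * r) / 10 * V R) / exp (sqrt (\<theta> * r) / 10 * V s1) \<le> (na s1 + nc s1) * (40 * r ^ 3)"
    using R by (simp add: field_simps power2_eq_square power3_eq_cube)
  then show ?thesis using R by (simp add: R_def exp_diff right_diff_distrib divide_le_eq mult_ac)
qed

end

section \<open>From the integral equation to the rotating frame\<close>

text \<open>Rotation by a real angle preserves the energy and the determinant
  \<open>Im (y2 * cnj y1)\<close>, so their limits at time 0 can be read off from the row itself.
  The rotation of the frame produces the terms with \<open>k'\<close>; the signs in front of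
  \<open>p\<close> reflect that time runs backwards in \<open>s\<close>.\<close>

lemma (in phase) frame_of_solution:
  fixes y1 y2 :: "real \<Rightarrow> complex" and z :: complex
  defines "a \<equiv> \<lambda>s. y1 s * cos (k s) + y2 s * sin (k s)"
    and "c \<equiv> \<lambda>s. y2 s * cos (k s) - y1 s * sin (k s)"
  assumes cont: "continuous_on {S..} y1" "continuous_on {S..} y2"
    and d1: "\<And>s. s > S \<Longrightarrow> (y1 has_vector_derivative p s * z * a s * sin (k s)) (at s)"
    and d2: "\<And>s. s > S \<Longrightarrow> (y2 has_vector_derivative - (p s * z * a s * cos (k s))) (at s)"
    and lim: "(y1 \<longlongrightarrow> e1) at_top" "(y2 \<longlongrightarrow> e2) at_top" "(cmod e1)\<^sup>2 + (cmod e2)\<^sup>2 = 1"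
  shows "frame k k' V S (\<lambda>s. (cmod (a s))\<^sup>2) (\<lambda>s. (cmod (c s))\<^sup>2)
    (\<lambda>s. Im (c s * cnj (a s))) (\<lambda>s. Re (c s * cnj (a s))) (Re z) (Im z)"
    and "(cmod (a s))\<^sup>2 + (cmod (c s))\<^sup>2 = (cmod (y1 s))\<^sup>2 + (cmod (y2 s))\<^sup>2"
    and "Im (c s * cnj (a s)) = Im (y2 s * cnj (y1 s))"
    and "(cmod (a s))\<^sup>2 * (sin (k s))\<^sup>2 + (cmod (c s))\<^sup>2 * (cos (k s))\<^sup>2
      + 2 * Re (c s * cnj (a s)) * sin (k s) * cos (k s) = (cmod (y2 s))\<^sup>2"
proof -
  define ar ai cr ci where "ar = (\<lambda>s. Re (y1 s) * cos (k s) + Re (y2 s) * sin (k s))"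
    and "ai = (\<lambda>s. Im (y1 s) * cos (k s) + Im (y2 s) * sin (k s))"
    and "cr = (\<lambda>s. Re (y2 s) * cos (k s) - Re (y1 s) * sin (k s))"
    and "ci = (\<lambda>s. Im (y2 s) * cos (k s) - Im (y1 s) * sin (k s))"
  have ac: "Re (a s) = ar s" "Im (a s) = ai s" "Re (c s) = cr s" "Im (c s) = ci s" for s
    by (simp_all add: a_def c_def ar_def ai_def cr_def ci_def)
  have energy: "(cmod (a s))\<^sup>2 + (cmod (c s))\<^sup>2 = (cmod (y1 s))\<^sup>2 + (cmod (y2 s))\<^sup>2" for s
    unfolding cmod_power2 ac ar_def ai_def cr_def ci_def
    using sin_cos_squared_add[of "k s"] by algebra
  then show "(cmod (a s))\<^sup>2 + (cmod (c s))\<^sup>2 = (cmod (y1 s))\<^sup>2 + (cmod (y2 s))\<^sup>2" .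
  show "Im (c s * cnj (a s)) = Im (y2 s * cnj (y1 s))"
    unfolding times_complex.sel cnj.sel ac ar_def ai_def cr_def ci_def
    using sin_cos_squared_add[of "k s"] by algebra
  show "(cmod (a s))\<^sup>2 * (sin (k s))\<^sup>2 + (cmod (c s))\<^sup>2 * (cos (k s))\<^sup>2
      + 2 * Re (c s * cnj (a s)) * sin (k s) * cos (k s) = (cmod (y2 s))\<^sup>2"
    unfolding cmod_power2 times_complex.sel cnj.sel ac ar_def ai_def cr_def ci_def
    using sin_cos_squared_add[of "k s"] by algebra
  have d: "((\<lambda>s. Re (y1 s)) has_real_derivative p s * (Re z * ar s - Im z * ai s) * sin (k s)) (at s)"
    "((\<lambda>s. Im (y1 s)) has_real_derivative p s * (Re z * ai s + Im z * ar s) * sin (k s)) (at s)"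
    "((\<lambda>s. Re (y2 s)) has_real_derivative - (p s * (Re z * ar s - Im z * ai s) * cos (k s))) (at s)"
    "((\<lambda>s. Im (y2 s)) has_real_derivative - (p s * (Re z * ai s + Im z * ar s) * cos (k s))) (at s)"
    if "s > S" for s
    using d1[OF that] d2[OF that] unfolding has_vector_derivative_complex_iff
    by (simp_all add: ac algebra_simps)
  define u1 v1 u2 v2 where "u1 = (\<lambda>s. Re (y1 s))" and "v1 = (\<lambda>s. Im (y1 s))"
    and "u2 = (\<lambda>s. Re (y2 s))" and "v2 = (\<lambda>s. Im (y2 s))"
  note uv = u1_def[THEN fun_cong, symmetric] v1_def[THEN fun_cong, symmetric]
    u2_def[THEN fun_cong, symmetric] v2_def[THEN fun_cong, symmetric]
  note d = d[folded u1_def v1_def u2_def v2_def]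
  have da: "(ar has_real_derivative k' s * cr s) (at s)" "(ai has_real_derivative k' s * ci s) (at s)"
    if "s > S" for s
    unfolding ar_def ai_def cr_def ci_def uv
    by (auto intro!: derivative_eq_intros d[OF that] k_deriv[OF that] simp: algebra_simps)
  have dc: "(cr has_real_derivative - k' s * ar s - p s * (Re z * ar s - Im z * ai s)) (at s)"
    "(ci has_real_derivative - k' s * ai s - p s * (Re z * ai s + Im z * ar s)) (at s)"
    if "s > S" for s
  proof -
    show "(cr has_real_derivative - k' s * ar s - p s * (Re z * ar s - Im z * ai s)) (at s)"
      unfolding cr_def uv
      by (rule derivative_eq_intros d[OF that] k_deriv[OF that] refl)+
        (unfold ar_def uv, use sin_cos_squared_add[of "k s"] in algebra)
    show "(ci has_real_derivative - k' s * ai s - p s * (Re z * ai s + Im z * ar s)) (at s)"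
      unfolding ci_def uv
      by (rule derivative_eq_intros d[OF that] k_deriv[OF that] refl)+
        (unfold ai_def uv, use sin_cos_squared_add[of "k s"] in algebra)
  qed
  have conta: "continuous_on {S..} a" "continuous_on {S..} c"
    unfolding a_def c_def by (intro continuous_intros cont k_cont)+
  show "frame k k' V S (\<lambda>s. (cmod (a s))\<^sup>2) (\<lambda>s. (cmod (c s))\<^sup>2)
    (\<lambda>s. Im (c s * cnj (a s))) (\<lambda>s. Re (c s * cnj (a s))) (Re z) (Im z)"
  proof unfold_locales
    show "continuous_on {S..} (\<lambda>s. (cmod (a s))\<^sup>2)" "continuous_on {S..} (\<lambda>s. (cmod (c s))\<^sup>2)"
      "continuous_on {S..} (\<lambda>s. Im (c s * cnj (a s)))" "continuous_on {S..} (\<lambda>s. Re (c s * cnj (a s)))"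
      by (intro continuous_intros conta)+
    show "(Im (c s * cnj (a s)))\<^sup>2 + (Re (c s * cnj (a s)))\<^sup>2 = (cmod (a s))\<^sup>2 * (cmod (c s))\<^sup>2" for s
      using cmod_power2[of "c s * cnj (a s)"] by (simp add: norm_mult power_mult_distrib mult.commute add.commute)
    have "((\<lambda>s. (cmod (y1 s))\<^sup>2 + (cmod (y2 s))\<^sup>2) \<longlongrightarrow> 1) at_top"
      unfolding lim(3)[symmetric] by (intro tendsto_intros lim)
    then show "((\<lambda>s. (cmod (a s))\<^sup>2 + (cmod (c s))\<^sup>2) \<longlongrightarrow> 1) at_top"
      unfolding energy .
    fix s assume s: "s > S"
    show "((\<lambda>s. (cmod (a s))\<^sup>2) has_real_derivative 2 * k' s * Re (c s * cnj (a s))) (at s)"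
      unfolding cmod_power2 times_complex.sel cnj.sel ac
      by (auto intro!: derivative_eq_intros da[OF s] simp: algebra_simps)
    show "((\<lambda>s. (cmod (c s))\<^sup>2) has_real_derivative - 2 * k' s * Re (c s * cnj (a s))
       - 2 * p s * (Re z * Re (c s * cnj (a s)) + Im z * Im (c s * cnj (a s)))) (at s)"
      unfolding cmod_power2 times_complex.sel cnj.sel ac
      by (auto intro!: derivative_eq_intros dc[OF s] simp: algebra_simps)
    show "((\<lambda>s. Im (c s * cnj (a s))) has_real_derivative - p s * Im z * (cmod (a s))\<^sup>2) (at s)"
      unfolding cmod_power2 times_complex.sel cnj.sel ac
      by (auto intro!: derivative_eq_intros da[OF s] dc[OF s] simp: algebra_simps power2_eq_square)
    show "((\<lambda>s. Re (c s * cnj (a s))) has_real_derivative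
       k' s * ((cmod (c s))\<^sup>2 - (cmod (a s))\<^sup>2) - p s * Re z * (cmod (a s))\<^sup>2) (at s)"
      unfolding cmod_power2 times_complex.sel cnj.sel ac
      by (auto intro!: derivative_eq_intros da[OF s] dc[OF s] simp: algebra_simps power2_eq_square)
  qed auto
qed

text \<open>As \<open>H\<close> is the projection onto the line at angle \<open>\<phi>\<close>, row
  \<open>i\<close> of \<open>W H\<close> is \<open>a\<close> times
  \<open>(cos \<phi>, sin \<phi>)\<close>. Multiplication by \<open>Jmat\<close> from the right puts
  the second entry of the row first and the negated first entry second; hence the cosine drives the
  second entry, and minus the sine drives the first.\<close>

lemma fundamental_solution_rows:
  fixes W :: "complex \<Rightarrow> real \<Rightarrow> complex^2^2" and \<phi> :: "real \<Rightarrow> real" and z :: complex and i :: 2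
  assumes fs: "fundamental_solution (Hmat \<phi>) b W" and t: "t \<in> {0..b}"
  defines "a \<equiv> \<lambda>s. W z s $ i $ 1 * cos (\<phi> s) + W z s $ i $ 2 * sin (\<phi> s)"
  shows "(\<lambda>s. z * a s * cos (\<phi> s)) integrable_on {0..t}"
    and "(\<lambda>s. z * a s * sin (\<phi> s)) integrable_on {0..t}"
    and "W z t $ i $ 2 = (if i = 2 then 1 else 0) + integral {0..t} (\<lambda>s. z * a s * cos (\<phi> s))"
    and "W z t $ i $ 1 = (if i = 1 then 1 else 0) - integral {0..t} (\<lambda>s. z * a s * sin (\<phi> s))"
proof -
  have int: "(\<lambda>s. W z s ** Hmat \<phi> s) integrable_on {0..t}"
    and eq: "W z t ** Jmat = Jmat + integral {0..t} (\<lambda>s. mat z ** (W z s ** Hmat \<phi> s))"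
    using fs t unfolding fundamental_solution_def by blast+
  have bl: "bounded_linear (\<lambda>M::complex^2^2. z * M $ i $ j)" for j
    by (intro bounded_linear_mult_right[THEN bounded_linear_compose]
        bounded_linear_compose[OF bounded_linear_vec_nth bounded_linear_vec_nth])
  have WH: "(W z s ** Hmat \<phi> s) $ i $ j = a s * xi (\<phi> s) j" for s j
    by (simp add: matrix_matrix_mult_def sum_2 Hmat_def xi_def a_def algebra_simps)
  have matz: "(mat z ** M) $ i $ j = z * M $ i $ j" for M :: "complex^2^2" and j
    using exhaust_2[of i] by (auto simp: matrix_matrix_mult_def sum_2 mat_def)
  have intz: "(\<lambda>s. mat z ** (W z s ** Hmat \<phi> s)) integrable_on {0..t}"
  proof -
    have "bounded_linear (\<lambda>M::complex^2^2. mat z ** M)"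
      by (intro linear_conv_bounded_linear[THEN iffD1] linearI)
        (auto simp: vec_eq_iff matrix_matrix_mult_def sum_2 algebra_simps)
    from integrable_linear[OF int this] show ?thesis by (simp add: o_def)
  qed
  have comp: "(\<lambda>s. z * (a s * xi (\<phi> s) j)) integrable_on {0..t}"
    "integral {0..t} (\<lambda>s. mat z ** (W z s ** Hmat \<phi> s)) $ i $ j = integral {0..t} (\<lambda>s. z * (a s * xi (\<phi> s) j))" for j
  proof -
    show "(\<lambda>s. z * (a s * xi (\<phi> s) j)) integrable_on {0..t}"
      using integrable_linear[OF int bl[of j]] by (simp add: o_def WH)
    show "integral {0..t} (\<lambda>s. mat z ** (W z s ** Hmat \<phi> s)) $ i $ j = integral {0..t} (\<lambda>s. z * (a s * xi (\<phi> s) j))"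
      using integral_linear[OF intz bounded_linear_compose[OF bounded_linear_vec_nth bounded_linear_vec_nth, of i j]]
      by (simp add: o_def WH matz)
  qed
  have xi: "xi x 1 = cos x" "xi x 2 = sin x" for x by (simp_all add: xi_def)
  show "(\<lambda>s. z * a s * cos (\<phi> s)) integrable_on {0..t}" "(\<lambda>s. z * a s * sin (\<phi> s)) integrable_on {0..t}"
    using comp(1)[of 1] comp(1)[of 2] by (simp_all add: xi mult.assoc)
  have WJ: "(W z t ** Jmat) $ i $ 1 = W z t $ i $ 2" "(W z t ** Jmat) $ i $ 2 = - W z t $ i $ 1"
    by (simp_all add: matrix_matrix_mult_def sum_2 Jmat_def)
  have J: "Jmat $ i $ 1 = (if i = 2 then 1 else 0)" "Jmat $ i $ 2 = - (if i = 1 then 1 else 0)"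
    by (simp_all add: Jmat_def)
  show "W z t $ i $ 2 = (if i = 2 then 1 else 0) + integral {0..t} (\<lambda>s. z * a s * cos (\<phi> s))"
    unfolding WJ(1)[symmetric] unfolding eq vector_add_component comp(2) J xi by (simp add: mult.assoc)
  have "- W z t $ i $ 1 = - (if i = 1 then 1 else 0) + integral {0..t} (\<lambda>s. z * a s * sin (\<phi> s))"
    unfolding WJ(2)[symmetric] unfolding eq vector_add_component comp(2) J xi by (simp add: mult.assoc)
  then show "W z t $ i $ 1 = (if i = 1 then 1 else 0) - integral {0..t} (\<lambda>s. z * a s * sin (\<phi> s))"
    by (metis (no_types) add.inverse_inverse minus_add_distrib diff_conv_add_uminus)
qed

text \<open>An indefinite integral is continuous up to the end points, including time 0, near which
  the angle may be unbounded and the integrand may oscillate.\<close>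

lemma fundamental_solution_continuous:
  assumes fs: "fundamental_solution (Hmat \<phi>) b W" and b: "b \<ge> 0"
  shows "continuous_on {0..b} (\<lambda>t. W z t $ i $ j)"
proof -
  have "b \<in> {0..b}" using b by simp
  note int = indefinite_integral_continuous_1[OF fundamental_solution_rows(1)[OF fs this]]
    indefinite_integral_continuous_1[OF fundamental_solution_rows(2)[OF fs this]]
  have "continuous_on {0..b} (\<lambda>t. W z t $ i $ 1)"
    by (subst continuous_on_cong[OF refl fundamental_solution_rows(4)[OF fs]])
      (auto intro!: continuous_intros int)
  moreover have "continuous_on {0..b} (\<lambda>t. W z t $ i $ 2)"
    by (subst continuous_on_cong[OF refl fundamental_solution_rows(3)[OF fs]])
      (auto intro!: continuous_intros int)
  ultimately show ?thesis using exhaust_2[of j] by auto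
qed

lemma fundamental_solution_deriv:
  fixes W :: "complex \<Rightarrow> real \<Rightarrow> complex^2^2" and \<phi> :: "real \<Rightarrow> real" and z :: complex and i :: 2
  assumes fs: "fundamental_solution (Hmat \<phi>) b W"
    and t: "0 < t" "t < b" and \<phi>: "isCont \<phi> t"
  defines "a \<equiv> W z t $ i $ 1 * cos (\<phi> t) + W z t $ i $ 2 * sin (\<phi> t)"
  shows "((\<lambda>t. W z t $ i $ 1) has_vector_derivative - (z * a * sin (\<phi> t))) (at t)"
    and "((\<lambda>t. W z t $ i $ 2) has_vector_derivative z * a * cos (\<phi> t)) (at t)"
proof -
  have b: "b \<in> {0..b}" using t by simp
  have at: "at t within {0..b} = at t" using t by (intro at_within_interior) auto
  have W: "isCont (\<lambda>t. W z t $ i $ j) t" for j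
    using fundamental_solution_continuous[OF fs, of z i j] t at
    by (auto simp: continuous_on_eq_continuous_within dest!: bspec[of _ _ t])
  have d: "((\<lambda>u. integral {0..u} h) has_vector_derivative h t) (at t)"
    if "h integrable_on {0..b}" "isCont h t" for h :: "real \<Rightarrow> complex"
    using integral_has_vector_derivative_continuous_at[OF that(1), of t "{}"] that t at by auto
  have "((\<lambda>u. (if i = 1 then 1 else 0) - integral {0..u}
      (\<lambda>s. z * (W z s $ i $ 1 * cos (\<phi> s) + W z s $ i $ 2 * sin (\<phi> s)) * sin (\<phi> s)))
      has_vector_derivative 0 - (z * a * sin (\<phi> t))) (at t)"
    unfolding a_def
    by (intro has_vector_derivative_diff has_vector_derivative_const
        d[OF fundamental_solution_rows(2)[OF fs b]] continuous_intros W \<phi>)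
  then show "((\<lambda>t. W z t $ i $ 1) has_vector_derivative - (z * a * sin (\<phi> t))) (at t)"
    by (simp, elim has_vector_derivative_transform_within_open[of _ _ _ "{0<..<b}"])
      (use t in \<open>auto simp: fundamental_solution_rows(4)[OF fs]\<close>)
  have "((\<lambda>u. (if i = 2 then 1 else 0) + integral {0..u}
      (\<lambda>s. z * (W z s $ i $ 1 * cos (\<phi> s) + W z s $ i $ 2 * sin (\<phi> s)) * cos (\<phi> s)))
      has_vector_derivative 0 + (z * a * cos (\<phi> t))) (at t)"
    unfolding a_def
    by (intro has_vector_derivative_add has_vector_derivative_const
        d[OF fundamental_solution_rows(1)[OF fs b]] continuous_intros W \<phi>)
  then show "((\<lambda>t. W z t $ i $ 2) has_vector_derivative z * a * cos (\<phi> t)) (at t)"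
    by (simp, elim has_vector_derivative_transform_within_open[of _ _ _ "{0<..<b}"])
      (use t in \<open>auto simp: fundamental_solution_rows(3)[OF fs]\<close>)
qed

text \<open>A monotone function with open image is continuous. Larger \<open>s\<close> means smaller
  time and larger angle, so \<open>- \<phi>\<close> is nondecreasing in time, and it maps the times
  strictly between 0 and \<open>tm S\<close> onto an open half line.\<close>

lemma (in phase) isCont_angle:
  assumes mono: "strict_mono_on {S..} k"
    and anti: "\<And>s s'. S \<le> s \<Longrightarrow> s < s' \<Longrightarrow> tm s' < tm s" and pos: "\<And>s. S \<le> s \<Longrightarrow> 0 < tm s"
    and lim: "filterlim k at_top at_top"
    and \<phi>: "\<And>s. S \<le> s \<Longrightarrow> \<phi> (tm s) = k s" and s: "s > S"
  shows "isCont \<phi> (tm s)"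
proof -
  have ex: "\<exists>s>S. t = tm s" if t: "0 < t" "t < tm S" for t
  proof -
    have "\<forall>\<^sub>F s in at_top. tm s < t" using order_tendstoD(2)[OF tm_tendsto t(1)] .
    then obtain s where s: "s \<ge> S" "tm s < t"
      by (metis eventually_at_top_linorder linorder_le_cases)
    then obtain s' where "S \<le> s'" "tm s' = t"
      using IVT2'[of tm s t S] t continuous_on_subset[OF tm_cont, of "{S..s}"] by auto
    then show ?thesis using t by (metis order_le_less order_less_irrefl)
  qed
  have im: "(\<lambda>t. - \<phi> t) ` {0<..<tm S} = {..< - k S}"
  proof (intro equalityI subsetI)
    fix x assume "x \<in> (\<lambda>t. - \<phi> t) ` {0<..<tm S}"
    then show "x \<in> {..< - k S}"
      using ex \<phi> strict_mono_onD[OF mono] by fastforce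
  next
    fix x assume "x \<in> {..< - k S}"
    then have x: "k S < - x" by simp
    have "\<forall>\<^sub>F s in at_top. k s \<ge> - x" using lim by (simp add: filterlim_at_top)
    then obtain s where s: "s \<ge> S" "- x \<le> k s"
      by (metis eventually_at_top_linorder linorder_le_cases)
    then obtain s' where s': "S \<le> s'" "k s' = - x"
      using IVT'[of k S "- x" s] x continuous_on_subset[OF k_cont, of "{S..s}"] by auto
    then have "S < s'" using x by (metis order_le_less order_less_irrefl)
    then have "tm s' \<in> {0<..<tm S}" "x = - \<phi> (tm s')" using anti pos \<phi> s' by auto
    then show "x \<in> (\<lambda>t. - \<phi> t) ` {0<..<tm S}" by blast
  qed
  have "continuous_on {0<..<tm S} (\<lambda>t. - \<phi> t)"
  proof (rule continuous_onI_mono)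
    show "open ((\<lambda>t. - \<phi> t) ` {0<..<tm S})" unfolding im by simp
    fix x y assume xy: "x \<in> {0<..<tm S}" "y \<in> {0<..<tm S}" "x \<le> y"
    obtain s where "s > S" "x = tm s" using ex[of x] xy by auto
    moreover obtain s' where "s' > S" "y = tm s'" using ex[of y] xy by auto
    ultimately have s: "s > S" "x = tm s" "s' > S" "y = tm s'" .
    then have "s' \<le> s" using anti[of s s'] xy by force
    then show "- \<phi> x \<le> - \<phi> y"
      using s \<phi> strict_mono_onD[OF mono, of s' s] by (cases "s' = s") auto
  qed
  then have "continuous_on {0<..<tm S} (\<lambda>t. - (- \<phi> t))" by (rule continuous_on_minus)
  moreover have "tm s \<in> {0<..<tm S}" using s anti pos by auto
  ultimately show ?thesis by (simp add: continuous_on_eq_continuous_at)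
qed

section \<open>Bounds for the monodromy matrix\<close>

text \<open>\<open>tm S\<close> is the length \<open>b\<close> of the interval. The angle is
  prescribed at the times \<open>tm s\<close>, all of them positive; at time 0 it may take any
  default value, a single point being invisible to the integral equation.\<close>

locale hamiltonian_phase = phase +
  fixes \<phi> :: "real \<Rightarrow> real" and W :: "complex \<Rightarrow> real \<Rightarrow> complex^2^2"
  assumes k_mono: "strict_mono_on {S..} k"
    and k_lim: "filterlim k at_top at_top"
    and tm_anti: "\<And>s s'. S \<le> s \<Longrightarrow> s < s' \<Longrightarrow> tm s' < tm s"
    and tm_pos: "\<And>s. S \<le> s \<Longrightarrow> 0 < tm s"
    and \<phi>: "\<And>s. S \<le> s \<Longrightarrow> \<phi> (tm s) = k s"
    and fs: "fundamental_solution (Hmat \<phi>) (tm S) W"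
begin

definition a :: "complex \<Rightarrow> 2 \<Rightarrow> real \<Rightarrow> complex" where
  "a z i s = W z (tm s) $ i $ 1 * cos (k s) + W z (tm s) $ i $ 2 * sin (k s)"

definition c :: "complex \<Rightarrow> 2 \<Rightarrow> real \<Rightarrow> complex" where
  "c z i s = W z (tm s) $ i $ 2 * cos (k s) - W z (tm s) $ i $ 1 * sin (k s)"

lemma tm_le: "S \<le> s \<Longrightarrow> tm s \<le> tm S"
  using tm_anti[of S s] by (cases "s = S") auto

lemma W_cont: "continuous_on {S..} (\<lambda>s. W z (tm s) $ i $ j)"
  by (rule continuous_on_compose2[OF fundamental_solution_continuous[OF fs] tm_cont])
    (use tm_le tm_pos in \<open>auto simp: less_imp_le\<close>)

lemma W_0: "W z 0 $ i $ j = (if i = j then 1 else 0)"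
  using fundamental_solution_rows(3,4)[OF fs, of 0 z i] tm_pos[of S] exhaust_2[of j]
  by (auto simp: less_imp_le)

lemma W_lim: "((\<lambda>s. W z (tm s) $ i $ j) \<longlongrightarrow> (if i = j then 1 else 0)) at_top"
proof -
  have "continuous_on {0..tm S} (\<lambda>t. W z t $ i $ j)"
    using fundamental_solution_continuous[OF fs] tm_pos[of S] by simp
  moreover have "\<forall>\<^sub>F s in at_top. tm s \<in> {0..tm S}"
    using eventually_ge_at_top[of S] by eventually_elim (use tm_le tm_pos in \<open>auto simp: less_imp_le\<close>)
  ultimately have "((\<lambda>s. W z (tm s) $ i $ j) \<longlongrightarrow> W z 0 $ i $ j) at_top"
    using tm_pos[of S] by (intro continuous_on_tendsto_compose[OF _ tm_tendsto]) auto
  then show ?thesis by (simp add: W_0)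
qed

lemma W_deriv:
  fixes z :: complex
  assumes s: "s > S"
  shows "((\<lambda>s. W z (tm s) $ i $ 1) has_vector_derivative p s * z * a z i s * sin (k s)) (at s)"
    and "((\<lambda>s. W z (tm s) $ i $ 2) has_vector_derivative - (p s * z * a z i s * cos (k s))) (at s)"
proof -
  have t: "0 < tm s" "tm s < tm S" using tm_pos tm_anti s by auto
  have "isCont \<phi> (tm s)"
    by (rule isCont_angle[OF k_mono tm_anti tm_pos k_lim \<phi> s])
  note d = fundamental_solution_deriv[OF fs t this, of z i, unfolded \<phi>[OF less_imp_le[OF s]], folded a_def]
  have dt: "(tm has_vector_derivative - p s) (at s)"
    using tm_deriv[OF s] by (simp add: has_real_derivative_iff_has_vector_derivative)
  show "((\<lambda>s. W z (tm s) $ i $ 1) has_vector_derivative p s * z * a z i s * sin (k s)) (at s)"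
    using vector_diff_chain_at[OF dt d(1)] by (simp add: o_def scaleR_conv_of_real mult.assoc)
  show "((\<lambda>s. W z (tm s) $ i $ 2) has_vector_derivative - (p s * z * a z i s * cos (k s))) (at s)"
    using vector_diff_chain_at[OF dt d(2)] by (simp add: o_def scaleR_conv_of_real mult.assoc)
qed

lemma e_norm: "(cmod (if i = 1 then 1 else 0))\<^sup>2 + (cmod (if i = 2 then 1 else 0))\<^sup>2 = 1" for i :: 2
  using exhaust_2[of i] by auto

lemma row_frame:
  shows "frame k k' V S (\<lambda>s. (cmod (a z i s))\<^sup>2) (\<lambda>s. (cmod (c z i s))\<^sup>2)
      (\<lambda>s. Im (c z i s * cnj (a z i s))) (\<lambda>s. Re (c z i s * cnj (a z i s))) (Re z) (Im z)"
    and "(cmod (a z i s))\<^sup>2 + (cmod (c z i s))\<^sup>2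
      = (cmod (W z (tm s) $ i $ 1))\<^sup>2 + (cmod (W z (tm s) $ i $ 2))\<^sup>2"
    and "Im (c z i s * cnj (a z i s)) = Im (W z (tm s) $ i $ 2 * cnj (W z (tm s) $ i $ 1))"
    and "(cmod (a z i s))\<^sup>2 * (sin (k s))\<^sup>2 + (cmod (c z i s))\<^sup>2 * (cos (k s))\<^sup>2
      + 2 * Re (c z i s * cnj (a z i s)) * sin (k s) * cos (k s) = (cmod (W z (tm s) $ i $ 2))\<^sup>2"
  unfolding a_def c_def
  by (rule frame_of_solution[of "\<lambda>s. W z (tm s) $ i $ 1" "\<lambda>s. W z (tm s) $ i $ 2" z,
      OF W_cont W_cont W_deriv(1)[unfolded a_def] W_deriv(2)[unfolded a_def] W_lim W_lim e_norm]; assumption)+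

lemma row_upper:
  assumes "cmod z \<ge> S"
  shows "(cmod (W z (tm S) $ i $ 1))\<^sup>2 + (cmod (W z (tm S) $ i $ 2))\<^sup>2
    \<le> cmod z * exp (k (cmod z) + 2 * sqrt (cmod z) * V (cmod z) + sqrt (cmod z) * (2 * k S - 2 * V S))"
  using frame.energy_upper[OF row_frame(1)[of z i]] assms
  unfolding cmod_def[symmetric] row_frame(2) by blast

text \<open>\<open>norm\<close> is here the Frobenius norm, whose square is the sum of the energies
  of the two rows; hence the factor 2.\<close>

lemma norm_W_upper:
  assumes "cmod z \<ge> S"
  shows "(norm (W z (tm S)))\<^sup>2
    \<le> 2 * (cmod z * exp (k (cmod z) + 2 * sqrt (cmod z) * V (cmod z) + sqrt (cmod z) * (2 * k S - 2 * V S)))"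
proof -
  have "(norm (W z (tm S)))\<^sup>2 = (\<Sum>i\<in>UNIV. (cmod (W z (tm S) $ i $ 1))\<^sup>2 + (cmod (W z (tm S) $ i $ 2))\<^sup>2)"
    by (simp add: norm_vec_def L2_set_def sum_2 real_sqrt_pow2)
  then show ?thesis using row_upper[OF assms, of 1] row_upper[OF assms, of 2] by (simp add: sum_2)
qed

text \<open>The second row starts from \<open>(0, 1)\<close>, which supplies the limits 0 of
  \<open>P\<close> and 1 of \<open>B\<close>.\<close>

lemma imaginary_row_frame:
  assumes "r \<ge> 0"
  defines "z \<equiv> \<i> * complex_of_real r"
  shows "imaginary_frame k k' V S (\<lambda>s. (cmod (a z 2 s))\<^sup>2) (\<lambda>s. (cmod (c z 2 s))\<^sup>2)
    (\<lambda>s. Im (c z 2 s * cnj (a z 2 s))) (\<lambda>s. Re (c z 2 s * cnj (a z 2 s))) r"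
proof -
  have "((\<lambda>s. Im (W z (tm s) $ 2 $ 2 * cnj (W z (tm s) $ 2 $ 1))) \<longlongrightarrow> Im (1 * cnj 0)) at_top"
    using W_lim[of z 2 1] W_lim[of z 2 2] by (intro tendsto_intros) auto
  moreover have "((\<lambda>s. (cmod (W z (tm s) $ 2 $ 2))\<^sup>2) \<longlongrightarrow> (cmod 1)\<^sup>2) at_top"
    using W_lim[of z 2 2] by (intro tendsto_intros) auto
  moreover have "Re z = 0" "Im z = r" by (simp_all add: z_def)
  ultimately show ?thesis
    using row_frame(1)[of z 2] assms(1)
    unfolding imaginary_frame_def imaginary_frame_axioms_def row_frame(3) row_frame(4) by simp
qed

lemma w22_ge_1:
  assumes "r \<ge> 0"
  shows "cmod (W (\<i> * complex_of_real r) (tm S) $ 2 $ 2) \<ge> 1"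
proof -
  interpret I: imaginary_frame k k' V S "\<lambda>s. (cmod (a (\<i> * complex_of_real r) 2 s))\<^sup>2"
    "\<lambda>s. (cmod (c (\<i> * complex_of_real r) 2 s))\<^sup>2"
    "\<lambda>s. Im (c (\<i> * complex_of_real r) 2 s * cnj (a (\<i> * complex_of_real r) 2 s))"
    "\<lambda>s. Re (c (\<i> * complex_of_real r) 2 s * cnj (a (\<i> * complex_of_real r) 2 s))" r
    by (rule imaginary_row_frame[OF assms])
  have "1 \<le> (cmod (W (\<i> * complex_of_real r) (tm S) $ 2 $ 2))\<^sup>2"
    using I.B_ge_1[of S] unfolding I.B_def row_frame(4) by simp
  then show ?thesis using power2_le_imp_le[of 1] by fastforce
qed

text \<open>The energy accumulated while \<open>s\<close> decreases from
  \<open>\<theta> * r / 10\<close> to \<open>s1\<close> is passed on to the entry \<open>w22\<close>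
  between \<open>s1\<close> and \<open>s2\<close>, and is kept until \<open>S\<close> because
  \<open>B\<close> is monotone. The constant is \<open>5120 = 40 * 128\<close>.\<close>

lemma w22_lower:
  assumes \<theta>: "0 < \<theta>" "\<theta> \<le> 1" and s: "S \<le> s2" "s2 \<le> s1" "s1 \<le> \<theta> * r / 10" and r: "r \<ge> 0"
    and k: "\<And>s. s > s1 \<Longrightarrow> (1 + \<theta>) * s * k' s \<le> k s"
    and cos: "\<And>s. s2 \<le> s \<Longrightarrow> s \<le> s1 \<Longrightarrow> (cos (k s))\<^sup>2 \<ge> 1 / 4"
    and rt: "r * (tm s2 - tm s1) \<ge> 1"
  shows "(cmod (W (\<i> * complex_of_real r) (tm S) $ 2 $ 2))\<^sup>2
    \<ge> exp (sqrt (\<theta> * r) / 10 * (V (\<theta> * r / 10) - V s1)) / (5120 * r ^ 3)"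
proof -
  interpret I: imaginary_frame k k' V S "\<lambda>s. (cmod (a (\<i> * complex_of_real r) 2 s))\<^sup>2"
    "\<lambda>s. (cmod (c (\<i> * complex_of_real r) 2 s))\<^sup>2"
    "\<lambda>s. Im (c (\<i> * complex_of_real r) 2 s * cnj (a (\<i> * complex_of_real r) 2 s))"
    "\<lambda>s. Re (c (\<i> * complex_of_real r) 2 s * cnj (a (\<i> * complex_of_real r) 2 s))" r
    by (rule imaginary_row_frame[OF r])
  have s1: "S \<le> s1" using s by simp
  let ?E = "(cmod (a (\<i> * complex_of_real r) 2 s1))\<^sup>2 + (cmod (c (\<i> * complex_of_real r) 2 s1))\<^sup>2"
  have E: "exp (sqrt (\<theta> * r) / 10 * (V (\<theta> * r / 10) - V s1)) / (40 * r ^ 3) \<le> ?E"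
    using k by (rule I.energy_lower[OF \<theta> s1 s(3)])
  have BE: "?E / 128 \<le> I.B s2"
    using cos by (rule I.B_ge_energy[OF s(1,2) _ rt])
  have B: "I.B s = (cmod (W (\<i> * complex_of_real r) (tm s) $ 2 $ 2))\<^sup>2" for s
    unfolding I.B_def row_frame(4) ..
  have "exp (sqrt (\<theta> * r) / 10 * (V (\<theta> * r / 10) - V s1)) / (5120 * r ^ 3)
      = exp (sqrt (\<theta> * r) / 10 * (V (\<theta> * r / 10) - V s1)) / (40 * r ^ 3) / 128"
    by simp
  also have "\<dots> \<le> ?E / 128" using E by (rule divide_right_mono) simp
  also have "\<dots> \<le> I.B s2" by (rule BE)
  also have "\<dots> \<le> I.B S" by (rule I.B_antimono[OF order_refl s(1)])
  finally show ?thesis unfolding B .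
qed

end

section \<open>Growth of the angle, and comparison of the bounds with \<open>f\<close>\<close>

lemma quotient_by_argument_decreasing:
  fixes k k' :: "real \<Rightarrow> real"
  assumes cont: "continuous_on {1..} k"
    and deriv: "\<And>s. s > 1 \<Longrightarrow> (k has_real_derivative k' s) (at s)"
    and pos: "\<And>s. s > 1 \<Longrightarrow> 0 < k s"
    and \<theta>: "0 < \<theta>" "\<And>s. s \<ge> s0 \<Longrightarrow> (1 + \<theta>) * s * k' s \<le> k s"
    and s: "1 \<le> s" "s0 \<le> s" "s < s'"
  shows "k s' / s' < k s / s"
proof (rule DERIV_neg_imp_decreasing_open[OF s(3)])
  fix x assume x: "s < x" "x < s'"
  then have x1: "x > 1" using s by simp
  have "((\<lambda>s. k s / s) has_real_derivative (k' x * x - k x) / (x * x)) (at x)"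
    using x1 by (auto intro!: derivative_eq_intros deriv)
  moreover have "k' x * x < k x"
  proof (cases "k' x * x \<le> 0")
    case False
    then have "0 < \<theta> * (k' x * x)" using \<theta>(1) by simp
    then show ?thesis using \<theta>(2)[of x] x s by (simp add: algebra_simps)
  qed (use pos[OF x1] in simp)
  ultimately show "\<exists>y. ((\<lambda>s. k s / s) has_real_derivative y) (at x) \<and> y < 0"
    using x1 by (intro exI conjI) (auto intro!: divide_neg_pos)
next
  show "continuous_on {s..s'} (\<lambda>s. k s / s)"
    using s by (intro continuous_intros continuous_on_subset[OF cont]) auto
qed

text \<open>The inequality with \<open>\<theta>\<close> makes
  \<open>(1 + \<theta>) * ln (k s) - ln s\<close> eventually nonincreasing, so \<open>k s\<close> is
  at most a constant times \<open>s powr (1 / (1 + \<theta>))\<close>, with an exponent below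
  1.\<close>

lemma quotient_by_argument_tendsto_0:
  fixes k k' :: "real \<Rightarrow> real"
  assumes cont: "continuous_on {1..} k"
    and deriv: "\<And>s. s > 1 \<Longrightarrow> (k has_real_derivative k' s) (at s)"
    and pos: "\<And>s. s > 1 \<Longrightarrow> 0 < k s"
    and \<theta>: "0 < \<theta>" "\<forall>\<^sub>F s in at_top. (1 + \<theta>) * s * k' s \<le> k s"
  shows "((\<lambda>s. k s / s) \<longlongrightarrow> 0) at_top"
proof -
  obtain s0' where s0': "\<And>s. s \<ge> s0' \<Longrightarrow> (1 + \<theta>) * s * k' s \<le> k s"
    using \<theta>(2) by (auto simp: eventually_at_top_linorder)
  define s0 where "s0 = max 2 s0'"
  have s0: "s0 \<ge> 2" "\<And>s. s \<ge> s0 \<Longrightarrow> (1 + \<theta>) * s * k' s \<le> k s" using s0' by (auto simp: s0_def)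
  define C where "C = (1 + \<theta>) * ln (k s0) - ln s0"
  have ln_le: "(1 + \<theta>) * ln (k s) - ln s \<le> C" if "s \<ge> s0" for s
    unfolding C_def
  proof (rule DERIV_nonpos_imp_decreasing_open[OF that])
    fix x assume x: "s0 < x" "x < s"
    then have x1: "x > 1" using s0 by simp
    have "((\<lambda>s. (1 + \<theta>) * ln (k s) - ln s) has_real_derivative (1 + \<theta>) * (k' x / k x) - 1 / x) (at x)"
      using x1 pos[OF x1] by (auto intro!: derivative_eq_intros deriv)
    moreover have "(1 + \<theta>) * (k' x / k x) \<le> 1 / x"
      using s0(2)[of x] x x1 pos[OF x1] by (simp add: field_simps)
    ultimately show "\<exists>y. ((\<lambda>s. (1 + \<theta>) * ln (k s) - ln s) has_real_derivative y) (at x) \<and> y \<le> 0"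
      by (intro exI conjI) auto
  next
    have "k x \<noteq> 0" if "x \<ge> s0" for x using that s0 pos[of x] by simp
    then show "continuous_on {s0..s} (\<lambda>s. (1 + \<theta>) * ln (k s) - ln s)"
      using s0 by (intro continuous_intros continuous_on_subset[OF cont]) auto
  qed
  define d where "d = 1 - 1 / (1 + \<theta>)"
  have d: "d > 0" using \<theta> by (simp add: d_def)
  have bound: "norm (k s / s) \<le> exp (C / (1 + \<theta>)) * s powr (- d)" if "s \<ge> s0" for s
  proof -
    have s1: "s > 1" and ks: "k s > 0" using that s0 pos by auto
    have "ln (k s) \<le> (C + ln s) / (1 + \<theta>)"
      using ln_le[OF that] \<theta> by (simp add: field_simps)
    moreover have "(C + ln s) / (1 + \<theta>) - ln s = C / (1 + \<theta>) + - d * ln s"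
      by (simp add: d_def add_divide_distrib algebra_simps)
    ultimately have "ln (k s) - ln s \<le> C / (1 + \<theta>) + - d * ln s" by linarith
    then have "exp (ln (k s) - ln s) \<le> exp (C / (1 + \<theta>) + - d * ln s)" by simp
    then show ?thesis using s1 ks unfolding exp_diff exp_add by (simp add: powr_def)
  qed
  have "((\<lambda>s. exp (C / (1 + \<theta>)) * s powr (- d)) \<longlongrightarrow> exp (C / (1 + \<theta>)) * 0) at_top"
    using d by (intro tendsto_intros tendsto_neg_powr filterlim_ident) auto
  then have lim: "((\<lambda>s. exp (C / (1 + \<theta>)) * s powr (- d)) \<longlongrightarrow> 0) at_top" by simp
  have "\<forall>\<^sub>F s in at_top. norm (k s / s) \<le> exp (C / (1 + \<theta>)) * s powr (- d)"
    using eventually_ge_at_top[of s0] by eventually_elim (rule bound)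
  then show ?thesis using lim by (rule Lim_null_comparison)
qed

text \<open>Logarithms turn the bounds into expressions with the main terms \<open>k r\<close> and
  \<open>sqrt r * V\<close>. All other terms are of order at most \<open>sqrt r\<close>, and are
  absorbed because \<open>V\<close> tends to infinity.\<close>

lemma (in hamiltonian_phase) growth:
  fixes f :: "real \<Rightarrow> real"
  assumes V_lim: "filterlim V at_top at_top"
    and \<theta>: "0 < \<theta>" "\<theta> \<le> 1" "\<forall>\<^sub>F s in at_top. (1 + \<theta>) * s * k' s \<le> k s"
    and kf: "\<exists>C>0. \<forall>\<^sub>F r in at_top. k r \<le> C * f r"
    and Vf: "\<exists>C>0. \<forall>\<^sub>F r in at_top. sqrt r * V r \<le> C * f r"
    and fV: "\<exists>C>0. \<forall>\<^sub>F r in at_top. f r \<le> C * (sqrt r * V (\<theta> * r / 10))"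
  shows "asymp_comparable (\<lambda>r. ln (Sup {norm (W z (tm S)) | z. cmod z = r}))
              (\<lambda>r. ln (cmod (W (\<i> * complex_of_real r) (tm S) $ 2 $ 2)))
            \<and> asymp_comparable
              (\<lambda>r. ln (cmod (W (\<i> * complex_of_real r) (tm S) $ 2 $ 2))) f"
proof -
  define F where "F = (\<lambda>r. ln (Sup {norm (W z (tm S)) | z. cmod z = r}))"
  define G where "G = (\<lambda>r. ln (cmod (W (\<i> * complex_of_real r) (tm S) $ 2 $ 2)))"
  obtain C1 where C1: "C1 > 0" "\<forall>\<^sub>F r in at_top. k r \<le> C1 * f r" using kf by blast
  obtain C2 where C2: "C2 > 0" "\<forall>\<^sub>F r in at_top. sqrt r * V r \<le> C2 * f r" using Vf by blast
  obtain C3 where C3: "C3 > 0" "\<forall>\<^sub>F r in at_top. f r \<le> C3 * (sqrt r * V (\<theta> * r / 10))" using fV by blast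
  define K where "K = \<bar>2 * k S - 2 * V S\<bar>"
  have ln_sqrt_le: "ln r \<le> 2 * sqrt r" if "r \<ge> 1" for r :: real
  proof -
    have "ln (sqrt r) \<le> sqrt r - 1" using that by (intro ln_le_minus_one) simp
    then show ?thesis using that by (simp add: ln_sqrt)
  qed
  have sup: "bdd_above {norm (W z (tm S)) | z. cmod z = r}"
    "F r \<le> (3 * sqrt r + k r + 2 * (sqrt r * V r) + sqrt r * K) / 2" "G r \<le> F r"
    if r: "r \<ge> S" for r
  proof -
    have r1: "r \<ge> 1" using r S_ge by simp
    define Y where "Y = 2 * (r * exp (k r + 2 * sqrt r * V r + sqrt r * (2 * k S - 2 * V S)))"
    have Y: "Y > 0" using r1 by (simp add: Y_def)
    have le: "x \<le> sqrt Y" if "x \<in> {norm (W z (tm S)) | z. cmod z = r}" for x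
      using that norm_W_upper r by (auto simp: Y_def intro!: real_le_rsqrt)
    then show bdd: "bdd_above {norm (W z (tm S)) | z. cmod z = r}" by (rule bdd_aboveI)
    let ?w = "W (\<i> * complex_of_real r) (tm S)"
    have mem: "norm ?w \<in> {norm (W z (tm S)) | z. cmod z = r}"
      using r1 by (auto intro!: exI[of _ "\<i> * complex_of_real r"] simp: norm_mult)
    have w: "1 \<le> cmod (?w $ 2 $ 2)" using w22_ge_1 r1 by simp
    have "cmod (?w $ 2 $ 2) \<le> norm (?w $ 2)" by (rule Finite_Cartesian_Product.norm_nth_le)
    also have "\<dots> \<le> norm ?w" by (rule Finite_Cartesian_Product.norm_nth_le)
    also have "\<dots> \<le> Sup {norm (W z (tm S)) | z. cmod z = r}"
      by (rule cSup_upper[OF mem bdd])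
    finally have *: "cmod (?w $ 2 $ 2) \<le> Sup {norm (W z (tm S)) | z. cmod z = r}" .
    then show "G r \<le> F r" using w unfolding G_def F_def by (intro ln_le_cancel_iff[THEN iffD2]) linarith+
    have "Sup {norm (W z (tm S)) | z. cmod z = r} \<le> sqrt Y"
      using mem le by (intro cSup_least) auto
    then have "F r \<le> ln (sqrt Y)" using * w unfolding F_def by (intro ln_le_cancel_iff[THEN iffD2]) linarith+
    also have "\<dots> = ln Y / 2" using Y by (simp add: ln_sqrt)
    also have "ln Y = ln 2 + ln r + (k r + 2 * (sqrt r * V r) + sqrt r * (2 * k S - 2 * V S))"
      using r1 by (simp add: Y_def ln_mult)
    finally have F: "F r \<le> (ln 2 + ln r + (k r + 2 * (sqrt r * V r) + sqrt r * (2 * k S - 2 * V S))) / 2" .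
    have K: "sqrt r * (2 * k S - 2 * V S) \<le> sqrt r * K"
      using r1 by (intro mult_left_mono) (auto simp: K_def)
    \<comment> \<open>The 3 collects \<open>ln 2 \<le> sqrt r\<close> and
      \<open>ln r \<le> 2 * sqrt r\<close>.\<close>
    have "x \<le> (3 * q + y + n) / 2"
      if "x \<le> (l + l' + (y + m)) / 2" "l \<le> 1" "1 \<le> q" "m \<le> n" "l' \<le> 2 * q"
      for x l l' y m n q :: real using that by simp
    from this[OF F less_imp_le[OF ln_2_less_1] _ K ln_sqrt_le[OF r1]]
    show "F r \<le> (3 * sqrt r + k r + 2 * (sqrt r * V r) + sqrt r * K) / 2"
      using r1 by (simp add: add.assoc)
  qed
  \<comment> \<open>Once \<open>V r \<ge> 1\<close>, also \<open>sqrt r\<close> is at most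
    \<open>C2 * f r\<close>; then 5 = 3 + 2 counts \<open>3 * sqrt r\<close> and
    \<open>2 * (sqrt r * V r)\<close>.\<close>
  define CU where "CU = (C1 + (5 + K) * C2) / 2"
  have CU: "CU > 0" using C1 C2 by (auto simp: CU_def K_def intro!: add_pos_nonneg)
  have upper: "\<forall>\<^sub>F r in at_top. F r \<le> CU * f r"
  proof -
    have V1: "\<forall>\<^sub>F r in at_top. V r \<ge> 1" using V_lim by (simp add: filterlim_at_top)
    show ?thesis
      using C1(2) C2(2) V1 eventually_ge_at_top[of S]
    proof eventually_elim
      case (elim r)
      have "sqrt r * 1 \<le> sqrt r * V r" using elim S_ge by (intro mult_left_mono) auto
      then have sr: "sqrt r \<le> C2 * f r" using elim by simp
      then have srK: "sqrt r * K \<le> C2 * f r * K" by (intro mult_right_mono) (auto simp: K_def)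
      have "F r \<le> (3 * sqrt r + k r + 2 * (sqrt r * V r) + sqrt r * K) / 2"
        by (rule sup(2)[OF elim(4)])
      also have "\<dots> \<le> (3 * (C2 * f r) + C1 * f r + 2 * (C2 * f r) + C2 * f r * K) / 2"
        by (intro divide_right_mono add_mono mult_left_mono elim(1,2) sr srK) simp_all
      also have "\<dots> = CU * f r" by (simp add: CU_def algebra_simps)
      finally show ?case .
    qed
  qed
  define CL where "CL = sqrt \<theta> / 40 / C3"
  have CL: "CL > 0" using C3 \<theta> by (simp add: CL_def)
  have lower: "\<forall>\<^sub>F r in at_top. CL * f r \<le> G r"
  proof -
    obtain s0' where s0': "\<And>s. s \<ge> s0' \<Longrightarrow> (1 + \<theta>) * s * k' s \<le> k s"
      using \<theta>(3) by (auto simp: eventually_at_top_linorder)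
    define s0 where "s0 = max S s0'"
    obtain n :: nat where "k s0 / (2 * pi) \<le> real n" using real_arch_simple by blast
    then have n: "k s0 \<le> 2 * real n * pi" by (simp add: field_simps)
    have ex: "\<exists>s\<ge>s0. k s = x" if "x \<ge> k s0" for x
    proof -
      have "\<forall>\<^sub>F s in at_top. k s \<ge> x" using k_lim by (simp add: filterlim_at_top)
      then obtain s where "s \<ge> s0" "x \<le> k s"
        by (metis eventually_at_top_linorder linorder_le_cases)
      then show ?thesis
        using IVT'[of k s0 x s] that continuous_on_subset[OF k_cont, of "{s0..s}"]
        by (auto simp: s0_def)
    qed
    \<comment> \<open>Between \<open>s2\<close> and \<open>s1\<close> the angle runs over an
      interval of length 1 that starts at a multiple of \<open>2 * pi\<close>. There the cosine is
      at least 1/2, as \<open>1 < pi / 3\<close>. The points \<open>s1\<close>, \<open>s2\<close> do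
      not depend on \<open>r\<close>, so \<open>V s1\<close> is a constant.\<close>
    obtain s2 where s2: "s2 \<ge> s0" "k s2 = 2 * real n * pi" using ex[OF n] by blast
    obtain s1 where s1: "s1 \<ge> s0" "k s1 = 2 * real n * pi + 1" using ex[of "2 * real n * pi + 1"] n by auto
    have S0: "S \<le> s0" by (simp add: s0_def)
    have mono: "k x \<le> k y" if "S \<le> x" "x \<le> y" for x y
      using strict_mono_onD[OF k_mono, of x y] that by (cases "x = y") auto
    have s21: "s2 < s1"
      using mono[of s1 s2] s1 s2 S0 by force
    have cos: "(cos (k s))\<^sup>2 \<ge> 1 / 4" if "s2 \<le> s" "s \<le> s1" for s
    proof -
      define x where "x = k s - 2 * real n * pi"
      have x: "0 \<le> x" "x \<le> 1"
        using mono[of s2 s] mono[of s s1] that s1 s2 S0 by (auto simp: x_def)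
      have "cos (k s) = cos (x + 2 * real n * pi)" by (simp add: x_def)
      also have "\<dots> = cos x" by (simp add: cos_add)
      finally have "cos (k s) = cos x" .
      moreover have "cos (pi / 3) \<le> cos x"
        using x pi_gt3 by (intro cos_monotone_0_pi_le) auto
      then have "cos x \<ge> 1 / 2" by (simp add: cos_60)
      then have "(1 / 2)\<^sup>2 \<le> (cos x)\<^sup>2" by (intro power_mono) auto
      ultimately show ?thesis by (simp add: power2_eq_square)
    qed
    define \<tau> where "\<tau> = tm s2 - tm s1"
    have \<tau>: "\<tau> > 0" using tm_anti[of s2 s1] s21 s2 S0 by (simp add: \<tau>_def)
    \<comment> \<open>In units of \<open>sqrt r\<close>, \<open>ln 5120 + 3 * ln r\<close> is at
      most \<open>5119 + 6 = 5125\<close>, and \<open>102500 = 20 * 5125\<close>. Beyond this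
      threshold \<open>V s1\<close> and the logarithms use up at most half of
      \<open>sqrt \<theta> / 10 * V\<close>. The other half, divided by 2 because \<open>w22\<close>
      enters squared, gives the 40 in \<open>CL\<close>.\<close>
    have V1: "\<forall>\<^sub>F r in at_top. V (\<theta> * r / 10) \<ge> 2 * V s1 + 102500 / sqrt \<theta>"
    proof -
      have "filterlim (\<lambda>r. \<theta> / 10 * r) at_top at_top"
        using \<theta> by (intro filterlim_tendsto_pos_mult_at_top[OF tendsto_const] filterlim_ident) auto
      then have "filterlim (\<lambda>r. V (\<theta> / 10 * r)) at_top at_top"
        by (rule filterlim_compose[OF V_lim])
      then show ?thesis by (simp add: filterlim_at_top)
    qed
    show ?thesis
      using C3(2) V1 eventually_ge_at_top[of "10 * s1 / \<theta>"] eventually_ge_at_top[of "1 / \<tau>"]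
        eventually_ge_at_top[of S]
    proof eventually_elim
      case (elim r)
      have r1: "r \<ge> 1" using elim S_ge by simp
      have sr1: "sqrt r \<ge> 1" using r1 by simp
      define U where "U = V (\<theta> * r / 10)"
      define X where "X = cmod (W (\<i> * complex_of_real r) (tm S) $ 2 $ 2)"
      have X: "X \<ge> 1" using w22_ge_1[of r] r1 by (simp add: X_def)
      have "exp (sqrt (\<theta> * r) / 10 * (U - V s1)) / (5120 * r ^ 3) \<le> X\<^sup>2"
        unfolding U_def X_def
      proof (rule w22_lower[OF \<theta>(1,2), where ?s2.0 = s2 and ?s1.0 = s1])
        show "s1 \<le> \<theta> * r / 10" using elim(3) \<theta>(1) by (simp add: field_simps)
        show "1 \<le> r * (tm s2 - tm s1)" using elim(4) \<tau> by (simp add: \<tau>_def[symmetric] field_simps)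
        show "(1 + \<theta>) * s * k' s \<le> k s" if "s1 < s" for s
          using s0'[of s] that s1 by (simp add: s0_def)
      qed (use S0 s2 s21 r1 cos in auto)
      then have "ln (exp (sqrt (\<theta> * r) / 10 * (U - V s1)) / (5120 * r ^ 3)) \<le> ln (X\<^sup>2)"
        using r1 X by (subst ln_le_cancel_iff) auto
      then have 1: "sqrt (\<theta> * r) / 10 * (U - V s1) - ln 5120 - 3 * ln r \<le> 2 * ln X"
        using r1 X by (simp add: ln_div ln_mult ln_realpow)
      have "ln (5120::real) \<le> 5119" using ln_le_minus_one[of "5120::real"] by simp
      then have "ln 5120 + 3 * ln r \<le> 5125 * sqrt r" using ln_sqrt_le[OF r1] sr1 by linarith
      then have 2: "sqrt r * (sqrt \<theta> / 10 * (U - V s1) - 5125) \<le> 2 * ln X"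
        using 1 by (simp add: real_sqrt_mult algebra_simps)
      have "sqrt \<theta> / 20 * (2 * V s1 + 102500 / sqrt \<theta>) \<le> sqrt \<theta> / 20 * U"
        using elim(2) \<theta>(1) unfolding U_def by (intro mult_left_mono) auto
      then have "sqrt \<theta> / 20 * U \<le> sqrt \<theta> / 10 * (U - V s1) - 5125"
        using \<theta>(1) by (simp add: algebra_simps)
      then have "sqrt r * (sqrt \<theta> / 20 * U) \<le> sqrt r * (sqrt \<theta> / 10 * (U - V s1) - 5125)"
        using r1 by (intro mult_left_mono) auto
      then have 3: "sqrt \<theta> / 40 * (sqrt r * U) \<le> ln X" using 2 by (simp add: algebra_simps)
      have "CL * f r \<le> CL * (C3 * (sqrt r * U))"
        using elim(1) CL by (intro mult_left_mono) (auto simp: U_def)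
      also have "\<dots> = sqrt \<theta> / 40 * (sqrt r * U)" using C3(1) by (simp add: CL_def)
      finally show ?case using 3 by (simp add: G_def X_def)
    qed
  qed
  have GF: "\<forall>\<^sub>F r in at_top. G r \<le> F r"
    using eventually_ge_at_top[of S] by eventually_elim (rule sup(3))
  have "asymp_comparable F G"
    unfolding asymp_comparable_def
  proof (rule exI[of _ 1], rule exI[of _ "CU / CL"], intro conjI)
    show "\<forall>\<^sub>F r in at_top. 1 * G r \<le> F r \<and> F r \<le> CU / CL * G r"
      using GF upper lower
    proof eventually_elim
      case (elim r)
      have "CU * f r = CU / CL * (CL * f r)" using CL by simp
      also have "\<dots> \<le> CU / CL * G r" using elim CU CL by (intro mult_left_mono) auto
      finally show ?case using elim by simp
    qed
  qed (use CU CL in auto)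
  moreover have "asymp_comparable G f"
    unfolding asymp_comparable_def
  proof (rule exI[of _ CL], rule exI[of _ CU], intro conjI)
    show "\<forall>\<^sub>F r in at_top. CL * f r \<le> G r \<and> G r \<le> CU * f r"
      using GF upper lower by eventually_elim auto
  qed (use CU CL in auto)
  ultimately show ?thesis unfolding F_def G_def by simp
qed

text \<open>With \<open>x = k s\<close> one has \<open>g x = k s / s\<close>, so \<open>s\<close>
  parametrises \<open>g\<close> and its inverse at once: at time \<open>tm s\<close> the angle is
  \<open>k s\<close>. The condition \<open>k 1 \<le> x0\<close> covers both cases of the theorem,
  \<open>x0 = k 1\<close> in the first and \<open>k 1 = 0\<close>, \<open>x0 = 1\<close> in the
  second.\<close>

lemma growth_of_inverse_angle:
  fixes k k' V f g :: "real \<Rightarrow> real" and x0 \<theta> :: real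
  assumes k_cont: "continuous_on {1..} k"
    and k_deriv: "\<And>s. s > 1 \<Longrightarrow> (k has_real_derivative k' s) (at s)"
    and k'_nonneg: "\<And>s. s > 1 \<Longrightarrow> 0 \<le> k' s"
    and k_mono: "strict_mono_on {1..} k"
    and k_lim: "filterlim k at_top at_top"
    and k1: "0 \<le> k 1"
    and V_cont: "continuous_on {1..} V"
    and V_deriv: "\<And>s. s > 1 \<Longrightarrow> (V has_real_derivative k' s / sqrt s) (at s)"
    and V_lim: "filterlim V at_top at_top"
    and \<theta>: "0 < \<theta>" "\<theta> \<le> 1" "\<forall>\<^sub>F s in at_top. (1 + \<theta>) * s * k' s \<le> k s"
    and kf: "\<exists>C>0. \<forall>\<^sub>F r in at_top. k r \<le> C * f r"
    and Vf: "\<exists>C>0. \<forall>\<^sub>F r in at_top. sqrt r * V r \<le> C * f r"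
    and fV: "\<exists>C>0. \<forall>\<^sub>F r in at_top. f r \<le> C * (sqrt r * V (\<theta> * r / 10))"
    and x0: "k 1 \<le> x0" and g: "\<And>x. x \<ge> x0 \<Longrightarrow> g x = x / inv_into {1..} k x"
  shows "(\<exists>xh>0. xh \<ge> x0 \<and> (\<forall>x y. xh \<le> x \<longrightarrow> x < y \<longrightarrow> g y < g x))
       \<and> (\<forall>xh W. xh > 0 \<and> xh \<ge> x0 \<and> (\<forall>x y. xh \<le> x \<longrightarrow> x < y \<longrightarrow> g y < g x) \<and>
              fundamental_solution (Hmat (\<lambda>t. inv_into {xh..} g t)) (g xh) W \<longrightarrow>
            asymp_comparable
              (\<lambda>r. ln (Sup {norm (W z (g xh)) | z. cmod z = r}))
              (\<lambda>r. ln (cmod (W (\<i> * complex_of_real r) (g xh) $ 2 $ 2)))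
            \<and> asymp_comparable
              (\<lambda>r. ln (cmod (W (\<i> * complex_of_real r) (g xh) $ 2 $ 2)))
              f)"
proof (intro conjI allI impI)
  have less: "k s < k s'" if "1 \<le> s" "s < s'" for s s'
    using strict_mono_onD[OF k_mono, of s s'] that by simp
  have less_iff: "k s < k s' \<longleftrightarrow> s < s'" if "1 \<le> s" "1 \<le> s'" for s s'
    using less[of s s'] less[of s' s] that by (metis less_irrefl linorder_cases order_less_trans)
  have pos: "0 < k s" if "s > 1" for s using less[of 1 s] k1 that by simp
  have ex: "\<exists>s\<ge>1. k s = x" if "x \<ge> k 1" for x
  proof -
    have "\<forall>\<^sub>F s in at_top. k s \<ge> x" using k_lim by (simp add: filterlim_at_top)
    then obtain s where "s \<ge> 1" "x \<le> k s"
      by (metis eventually_at_top_linorder linorder_le_cases)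
    then show ?thesis
      using IVT'[of k 1 x s] that continuous_on_subset[OF k_cont, of "{1..s}"] by auto
  qed
  have gk: "g (k s) = k s / s" if "s \<ge> 1" "k s \<ge> x0" for s
    using g[of "k s"] that inv_into_f_f[OF strict_mono_on_imp_inj_on[OF k_mono], of s] by simp
  show "\<exists>xh>0. xh \<ge> x0 \<and> (\<forall>x y. xh \<le> x \<longrightarrow> x < y \<longrightarrow> g y < g x)"
  proof -
    obtain s0 where s0: "\<And>s. s \<ge> s0 \<Longrightarrow> (1 + \<theta>) * s * k' s \<le> k s"
      using \<theta>(3) by (auto simp: eventually_at_top_linorder)
    \<comment> \<open>Beyond \<open>k (max 1 s0)\<close> the parameter \<open>s\<close> lies in the
      range of the inequality with \<open>\<theta>\<close>; the maximum with 1 makes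
      \<open>xh\<close> positive.\<close>
    define xh where "xh = max 1 (max x0 (k (max 1 s0)))"
    have "g y < g x" if xy: "xh \<le> x" "x < y" for x y
    proof -
      have "k 1 \<le> xh" using x0 by (simp add: xh_def)
      obtain s where s: "s \<ge> 1" "k s = x" using ex[of x] \<open>k 1 \<le> xh\<close> xy by auto
      obtain s' where s': "s' \<ge> 1" "k s' = y" using ex[of y] \<open>k 1 \<le> xh\<close> xy by auto
      have "s < s'" using less_iff[of s s'] s s' xy by simp
      moreover have "s0 \<le> s"
        using less_iff[of s "max 1 s0"] s xy by (auto simp: xh_def)
      ultimately have "k s' / s' < k s / s"
        using s by (intro quotient_by_argument_decreasing[OF k_cont k_deriv pos \<theta>(1) s0]) auto
      then show ?thesis using gk[of s] gk[of s'] s s' xy by (simp add: xh_def)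
    qed
    then show ?thesis by (intro exI[of _ xh]) (auto simp: xh_def)
  qed
  fix xh W
  assume *: "xh > 0 \<and> xh \<ge> x0 \<and> (\<forall>x y. xh \<le> x \<longrightarrow> x < y \<longrightarrow> g y < g x) \<and>
              fundamental_solution (Hmat (\<lambda>t. inv_into {xh..} g t)) (g xh) W"
  obtain S where S: "S \<ge> 1" "k S = xh" using ex[of xh] x0 * by auto
  have kS: "k s \<ge> xh" if "s \<ge> S" for s using less[of S s] S that by (cases "s = S") auto
  have gS: "g (k s) = k s / s" if "s \<ge> S" for s using gk[of s] kS[OF that] S that * by simp
  have dec: "k s' / s' < k s / s" if "S \<le> s" "s < s'" for s s'
  proof -
    have "g (k s') < g (k s)" using * kS[OF that(1)] less[of s s'] S that by simp
    then show ?thesis using gS[of s] gS[of s'] that by simp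
  qed
  interpret phase k k' V S
  proof
    fix s assume s: "s > S"
    then have s1: "s > 1" using S by simp
    show "(k has_real_derivative k' s) (at s)" by (rule k_deriv[OF s1])
    show "(V has_real_derivative k' s / sqrt s) (at s)" by (rule V_deriv[OF s1])
    show "0 \<le> k' s" by (rule k'_nonneg[OF s1])
    \<comment> \<open>The given \<open>xh\<close> may lie below the range where the inequality with
      \<open>\<theta>\<close> is known, so the monotonicity of \<open>g\<close> is used instead:
      otherwise \<open>k s / s\<close> would increase immediately to the right of
      \<open>s\<close>.\<close>
    show "s * k' s \<le> k s"
    proof (rule ccontr)
      assume "\<not> ?thesis"
      then have "(k' s * s - k s) / (s * s) > 0" using s1 by (simp add: mult.commute)
      moreover have "((\<lambda>s. k s / s) has_real_derivative (k' s * s - k s) / (s * s)) (at s)"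
        using s1 by (auto intro!: derivative_eq_intros k_deriv)
      ultimately obtain d where d: "d > 0" "\<And>h. h > 0 \<Longrightarrow> h < d \<Longrightarrow> k s / s < k (s + h) / (s + h)"
        using DERIV_pos_inc_right by blast
      have "k s / s < k (s + d / 2) / (s + d / 2)" using d by simp
      moreover have "k (s + d / 2) / (s + d / 2) < k s / s" using dec[of s "s + d / 2"] s d(1) by simp
      ultimately show False by simp
    qed
  next
    show "continuous_on {S..} k" by (rule continuous_on_subset[OF k_cont]) (use S in auto)
    show "continuous_on {S..} V" by (rule continuous_on_subset[OF V_cont]) (use S in auto)
    show "((\<lambda>s. k s / s) \<longlongrightarrow> 0) at_top"
      by (rule quotient_by_argument_tendsto_0[OF k_cont k_deriv pos \<theta>(1,3)])
    show "1 \<le> S" by (rule S)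
    show "0 \<le> k s" if "s \<ge> S" for s using kS[OF that] * by simp
  qed
  have tmS: "tm S = g xh" using gS[of S] S by (simp add: tm_def)
  interpret hamiltonian_phase k k' V S "inv_into {xh..} g" W
  proof
    show "strict_mono_on {S..} k" using S by (intro strict_mono_onI less) auto
    show "filterlim k at_top at_top" by (rule k_lim)
    show "tm s' < tm s" if "S \<le> s" "s < s'" for s s' using dec[OF that] by (simp add: tm_def)
    show "0 < tm s" if "S \<le> s" for s
      using kS[OF that] S that * by (auto simp: tm_def intro!: divide_pos_pos)
    show "inv_into {xh..} g (tm s) = k s" if "S \<le> s" for s
    proof -
      have "inj_on g {xh..}"
        by (intro linorder_inj_onI') (use * in force)
      then show ?thesis using inv_into_f_f[of g "{xh..}" "k s"] kS[OF that] gS[OF that] by (simp add: tm_def)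
    qed
    show "fundamental_solution (Hmat (inv_into {xh..} g)) (tm S) W"
      using * by (simp add: tmS)
  qed
  from growth[OF V_lim \<theta> kf Vf fV, unfolded tmS]
  show "asymp_comparable
              (\<lambda>r. ln (Sup {norm (W z (g xh)) | z. cmod z = r}))
              (\<lambda>r. ln (cmod (W (\<i> * complex_of_real r) (g xh) $ 2 $ 2)))"
    and "asymp_comparable
              (\<lambda>r. ln (cmod (W (\<i> * complex_of_real r) (g xh) $ 2 $ 2))) f" by auto
qed

section \<open>Smoothly varying functions and their integrals\<close>

text \<open>\<open>e s\<close> is \<open>h' (ln s)\<close> for \<open>h x = ln (v (exp x))\<close>,
  so it is the local exponent \<open>s v' / v\<close>. The growth comparisons in both cases reduce
  to bounds on \<open>e\<close> for large \<open>s\<close>.\<close>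

lemma smoothly_varying_logarithmic_derivative:
  assumes "smoothly_varying v \<alpha>"
  obtains e where "\<And>s. s \<ge> 1 \<Longrightarrow> 0 < v s" "continuous_on {1..} v" "continuous_on {1..} e"
    "\<And>s. s > 1 \<Longrightarrow> (v has_real_derivative v s * e s / s) (at s)" "(e \<longlongrightarrow> \<alpha>) at_top"
proof -
  obtain D where pos: "\<And>x. x \<ge> 1 \<Longrightarrow> v x > 0"
    and D0: "\<And>x. x \<ge> 0 \<Longrightarrow> D 0 x = ln (v (exp x))"
    and D: "\<And>n x. x \<ge> 0 \<Longrightarrow> (D n has_real_derivative D (Suc n) x) (at x within {0..})"
    and lim: "(D 1 \<longlongrightarrow> \<alpha>) at_top"
    using assms unfolding smoothly_varying_def by blast
  have v: "v s = exp (D 0 (ln s))" if "s \<ge> 1" for s using that D0[of "ln s"] pos[of s] by simp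
  have Dcont: "continuous_on {0..} (D n)" for n
    by (rule DERIV_continuous_on[OF D]) auto
  have cont: "continuous_on {1..} (\<lambda>s. D n (ln s))" for n
    by (rule continuous_on_compose2[OF Dcont]) (auto intro!: continuous_intros)
  show thesis
  proof (rule that[of "\<lambda>s. D 1 (ln s)"])
    show "0 < v s" if "s \<ge> 1" for s by (rule pos[OF that])
    have "continuous_on {1..} (\<lambda>s. exp (D 0 (ln s)))" by (intro continuous_intros cont)
    then show "continuous_on {1..} v" by (subst continuous_on_cong[OF refl v]) auto
    show "continuous_on {1..} (\<lambda>s. D 1 (ln s))" by (rule cont)
    show "((\<lambda>s. D 1 (ln s)) \<longlongrightarrow> \<alpha>) at_top" by (rule filterlim_compose[OF lim ln_at_top])
    fix s :: real assume s: "s > 1"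
    have "at (ln s) within {0..} = at (ln s)"
      using s by (intro at_within_interior) simp
    then have "(D 0 has_real_derivative D 1 (ln s)) (at (ln s))" using D[of "ln s" 0] s by simp
    then have "((\<lambda>s. exp (D 0 (ln s))) has_real_derivative
        exp (D 0 (ln s)) * (D 1 (ln s) * (1 / s))) (at s)"
      using s by (auto intro!: derivative_eq_intros DERIV_chain2[of "D 0"])
    then have "((\<lambda>s. exp (D 0 (ln s))) has_real_derivative v s * D 1 (ln s) / s) (at s)"
      using s by (simp add: v)
    then show "(v has_real_derivative v s * D 1 (ln s) / s) (at s)"
      by (rule has_field_derivative_transform_within_open[where S = "{1<..}"]) (use s v in auto)
  qed
qed

lemma integral_from_1:
  fixes h :: "real \<Rightarrow> real"
  assumes cont: "continuous_on {1..} h"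
  shows "s > 1 \<Longrightarrow> ((\<lambda>r. integral {1..r} h) has_real_derivative h s) (at s)"
    and "continuous_on {1..} (\<lambda>r. integral {1..r} h)"
proof -
  have c: "continuous_on {1..b} h" for b by (rule continuous_on_subset[OF cont]) auto
  show "((\<lambda>r. integral {1..r} h) has_real_derivative h s) (at s)" if "s > 1"
  proof -
    have "at s within {1..s + 1} = at s" using that by (intro at_within_interior) auto
    then show ?thesis using integral_has_real_derivative[OF c, of s "s + 1"] that by simp
  qed
  show "continuous_on {1..} (\<lambda>r. integral {1..r} h)"
    unfolding continuous_on_eq_continuous_within
  proof
    fix s :: real assume "s \<in> {1..}"
    then have "continuous (at s within {1..s + 1}) (\<lambda>r. integral {1..r} h)"
      using indefinite_integral_continuous_1[OF integrable_continuous_real[OF c]]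
      by (auto simp: continuous_on_eq_continuous_within)
    moreover have "at s within {1..s + 1} = at s within {1..}"
      by (rule at_within_nhd[of s "{..<s + 1}"]) auto
    ultimately show "continuous (at s within {1..}) (\<lambda>r. integral {1..r} h)" by simp
  qed
qed

text \<open>\<open>ln (f s) - \<beta> * ln s\<close> is eventually nondecreasing, so
  \<open>f s\<close> is at least a positive constant times \<open>s powr \<beta>\<close>, which
  outgrows \<open>s powr \<gamma>\<close>.\<close>

lemma filterlim_over_powr:
  fixes f e :: "real \<Rightarrow> real"
  assumes pos: "\<And>s. s \<ge> 1 \<Longrightarrow> 0 < f s" and cont: "continuous_on {1..} f"
    and deriv: "\<And>s. s > 1 \<Longrightarrow> (f has_real_derivative f s * e s / s) (at s)"
    and e: "\<forall>\<^sub>F s in at_top. \<beta> \<le> e s" and \<beta>: "\<gamma> < \<beta>"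
  shows "filterlim (\<lambda>s. f s / s powr \<gamma>) at_top at_top"
proof -
  obtain s0' where s0': "\<And>s. s \<ge> s0' \<Longrightarrow> \<beta> \<le> e s" using e by (auto simp: eventually_at_top_linorder)
  define s0 where "s0 = max 1 s0'"
  define C where "C = ln (f s0) - \<beta> * ln s0"
  have ln_ge: "C \<le> ln (f s) - \<beta> * ln s" if "s \<ge> s0" for s
    unfolding C_def
  proof (rule DERIV_nonneg_imp_increasing_open[OF that])
    fix x assume x: "s0 < x" "x < s"
    then have x1: "x > 1" by (simp add: s0_def)
    have "((\<lambda>s. ln (f s) - \<beta> * ln s) has_real_derivative (e x - \<beta>) / x) (at x)"
      using x1 pos[of x] by (auto intro!: derivative_eq_intros deriv simp: field_simps)
    then show "\<exists>y. ((\<lambda>s. ln (f s) - \<beta> * ln s) has_real_derivative y) (at x) \<and> 0 \<le> y"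
      using s0'[of x] x x1 by (intro exI conjI) (auto simp: s0_def)
  next
    have "f x \<noteq> 0" if "x \<ge> s0" for x using pos[of x] that by (simp add: s0_def)
    then show "continuous_on {s0..s} (\<lambda>s. ln (f s) - \<beta> * ln s)"
      by (intro continuous_intros continuous_on_subset[OF cont]) (auto simp: s0_def)
  qed
  have "filterlim (\<lambda>s. exp (C + (\<beta> - \<gamma>) * ln s)) at_top at_top"
    using \<beta> by (intro filterlim_compose[OF exp_at_top] filterlim_tendsto_add_at_top[OF tendsto_const]
        filterlim_tendsto_pos_mult_at_top[OF tendsto_const] ln_at_top) auto
  then show ?thesis
  proof (rule filterlim_at_top_mono)
    show "\<forall>\<^sub>F s in at_top. exp (C + (\<beta> - \<gamma>) * ln s) \<le> f s / s powr \<gamma>"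
      using eventually_ge_at_top[of s0]
    proof eventually_elim
      case (elim s)
      have s: "s \<ge> 1" using elim by (simp add: s0_def)
      have "exp (C + (\<beta> - \<gamma>) * ln s) \<le> exp (ln (f s) - \<gamma> * ln s)"
        using ln_ge[OF elim] by (simp add: algebra_simps)
      then show ?case using pos[OF s] s by (simp add: exp_diff powr_def)
    qed
  qed
qed

section \<open>The growth conditions in the two cases\<close>

theorem theorem6p13:
  fixes f g :: "real \<Rightarrow> real" and x0 :: real
  assumes cases:
    "(\<exists>\<alpha>. smoothly_varying f \<alpha> \<and> 1/2 < \<alpha> \<and> \<alpha> < 1 \<and> strict_mono_on {1..} f \<and>
          x0 = f 1 \<and> (\<forall>x\<ge>x0. g x = x / inv_into {1..} f x))
     \<or> (\<exists>v. smoothly_varying v (-1) \<and>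
          filterlim (\<lambda>r. integral {1..r} v) at_top at_top \<and>
          (\<forall>r\<ge>1. f r = sqrt r * integral {1..r} v) \<and>
          x0 = 1 \<and>
          (\<forall>x\<ge>x0. g x = x / inv_into {1..} (\<lambda>r. integral {1..r} (\<lambda>s. sqrt s * v s)) x))"
  shows "(\<exists>xh>0. xh \<ge> x0 \<and> (\<forall>x y. xh \<le> x \<longrightarrow> x < y \<longrightarrow> g y < g x))
       \<and> (\<forall>xh W. xh > 0 \<and> xh \<ge> x0 \<and> (\<forall>x y. xh \<le> x \<longrightarrow> x < y \<longrightarrow> g y < g x) \<and>
              fundamental_solution (Hmat (\<lambda>t. inv_into {xh..} g t)) (g xh) W \<longrightarrow>
            asymp_comparable
              (\<lambda>r. ln (Sup {norm (W z (g xh)) | z. cmod z = r}))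
              (\<lambda>r. ln (cmod (W (\<i> * complex_of_real r) (g xh) $ 2 $ 2)))
            \<and> asymp_comparable
              (\<lambda>r. ln (cmod (W (\<i> * complex_of_real r) (g xh) $ 2 $ 2)))
              f)"
  using cases
proof (elim disjE exE conjE)
  fix \<alpha>
  assume sv: "smoothly_varying f \<alpha>" and \<alpha>: "1/2 < \<alpha>" "\<alpha> < 1" and mono: "strict_mono_on {1..} f"
    and x0: "x0 = f 1" and g: "\<forall>x\<ge>x0. g x = x / inv_into {1..} f x"
  obtain e where pos: "\<And>s. s \<ge> 1 \<Longrightarrow> 0 < f s" and f_cont: "continuous_on {1..} f"
    and e_cont: "continuous_on {1..} e"
    and f_deriv: "\<And>s. s > 1 \<Longrightarrow> (f has_real_derivative f s * e s / s) (at s)"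
    and e_lim: "(e \<longlongrightarrow> \<alpha>) at_top"
    using smoothly_varying_logarithmic_derivative[OF sv] by blast
  define f' where "f' = (\<lambda>s. f s * e s / s)"
  note f'_deriv = f_deriv[folded f'_def[THEN fun_cong]]
  have f'_nonneg: "0 \<le> f' s" if "s > 1" for s
    by (rule mono_on_imp_deriv_nonneg[OF strict_mono_on_imp_mono_on[OF mono] f'_deriv[OF that]])
      (use that in \<open>simp\<close>)
  \<comment> \<open>\<open>1 + \<theta>\<close> is the midpoint of 1 and
    \<open>1 / \<alpha>\<close>, so the local exponent is eventually below
    \<open>1 / (1 + \<theta>)\<close>.\<close>
  define \<theta> where "\<theta> = (1 / \<alpha> - 1) / 2"
  have \<theta>: "0 < \<theta>" "\<theta> \<le> 1" "\<alpha> < 1 / (1 + \<theta>)"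
    using \<alpha> by (auto simp: \<theta>_def field_simps)
  have \<theta>_ev: "\<forall>\<^sub>F s in at_top. (1 + \<theta>) * s * f' s \<le> f s"
    using order_tendstoD(2)[OF e_lim \<theta>(3)] eventually_ge_at_top[of 1]
  proof eventually_elim
    case (elim s)
    have "f s * ((1 + \<theta>) * e s) \<le> f s * 1"
      using elim \<theta> pos[of s] by (intro mult_left_mono) (auto simp: field_simps)
    then show ?case using elim by (simp add: f'_def mult_ac)
  qed
  then obtain s0 where s0: "\<And>s. s \<ge> s0 \<Longrightarrow> (1 + \<theta>) * s * f' s \<le> f s"
    by (auto simp: eventually_at_top_linorder)
  \<comment> \<open>This lower bound for the local exponent still exceeds 1/2: it makes
    \<open>f s / sqrt s\<close> tend to infinity and, up to constants, dominate
    \<open>V\<close>.\<close>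
  define \<beta> where "\<beta> = (\<alpha> + 1 / 2) / 2"
  have \<beta>: "1 / 2 < \<beta>" "\<beta> < \<alpha>" using \<alpha> by (auto simp: \<beta>_def)
  have \<beta>_ev: "\<forall>\<^sub>F s in at_top. \<beta> \<le> e s"
    using order_tendstoD(1)[OF e_lim \<beta>(2)] by eventually_elim simp
  then obtain s3' where s3': "\<And>s. s \<ge> s3' \<Longrightarrow> \<beta> \<le> e s" by (auto simp: eventually_at_top_linorder)
  define s3 where "s3 = max 1 s3'"
  have "filterlim (\<lambda>s. f s / s powr (1 / 2)) at_top at_top"
    by (rule filterlim_over_powr[OF pos f_cont f_deriv \<beta>_ev \<beta>(1)])
  then have f_over_sqrt: "filterlim (\<lambda>s. f s / sqrt s) at_top at_top"
    by (rule filterlim_at_top_mono)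
      (use eventually_ge_at_top[of 1] in \<open>eventually_elim, simp add: powr_half_sqrt\<close>)
  have f_lim: "filterlim f at_top at_top"
  proof (rule filterlim_at_top_mono[OF f_over_sqrt])
    show "\<forall>\<^sub>F s in at_top. f s / sqrt s \<le> f s"
      using eventually_ge_at_top[of 1]
    proof eventually_elim
      case (elim s)
      then show ?case using pos[of s] by (simp add: divide_le_eq mult_le_cancel_left1)
    qed
  qed
  define h where "h = (\<lambda>s. f' s / sqrt s)"
  have "continuous_on {1..} h"
    unfolding h_def f'_def by (intro continuous_intros f_cont e_cont) auto
  note V_facts = integral_from_1[OF this]
  define V where "V = (\<lambda>r. integral {1..r} h)"
  note V_cont = V_facts(2)[folded V_def]
  have V_deriv: "(V has_real_derivative f' s / sqrt s) (at s)" if "s > 1" for s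
    using V_facts(1)[OF that] by (simp add: V_def h_def)
  \<comment> \<open>Integration by parts: the difference of the two sides has the derivative
    \<open>(f - f 1) / (2 s^(3/2))\<close>, which is nonnegative.\<close>
  have V_ge: "(f r - f 1) / sqrt r \<le> V r" if "r \<ge> 1" for r
  proof -
    have "V 1 - (f 1 - f 1) / sqrt 1 \<le> V r - (f r - f 1) / sqrt r"
    proof (rule DERIV_nonneg_imp_increasing_open[OF that])
      fix x assume x: "1 < x" "x < r"
      have "((\<lambda>s. V s - (f s - f 1) / sqrt s) has_real_derivative
          f' x / sqrt x - (f' x * sqrt x - (f x - f 1) * (inverse (sqrt x) / 2)) / (sqrt x * sqrt x)) (at x)"
        using x by (auto intro!: derivative_eq_intros V_deriv f'_deriv)
      moreover have "f' x / sqrt x - (f' x * sqrt x - (f x - f 1) * (inverse (sqrt x) / 2)) / (sqrt x * sqrt x)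
          = (f x - f 1) / (2 * x * sqrt x)"
        using x by (simp add: field_simps)
      moreover have "f 1 < f x" using strict_mono_onD[OF mono, of 1 x] x by simp
      ultimately show "\<exists>y. ((\<lambda>s. V s - (f s - f 1) / sqrt s) has_real_derivative y) (at x) \<and> 0 \<le> y"
        using x by (intro exI conjI) auto
    next
      show "continuous_on {1..r} (\<lambda>s. V s - (f s - f 1) / sqrt s)"
        by (intro continuous_intros continuous_on_subset[OF V_cont] continuous_on_subset[OF f_cont]) auto
    qed
    then show ?thesis by (simp add: V_def)
  qed
  have V_lim: "filterlim V at_top at_top"
  proof (rule filterlim_at_top_mono)
    show "filterlim (\<lambda>s. - f 1 + f s / sqrt s) at_top at_top"
      by (intro filterlim_tendsto_add_at_top[OF tendsto_const] f_over_sqrt)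
    show "\<forall>\<^sub>F s in at_top. - f 1 + f s / sqrt s \<le> V s"
      using eventually_ge_at_top[of 1]
    proof eventually_elim
      case (elim s)
      have "f 1 / sqrt s \<le> f 1"
        using elim pos[of 1] by (simp add: divide_le_eq mult_le_cancel_left1)
      then show ?case using V_ge[OF elim] by (simp add: diff_divide_distrib)
    qed
  qed
  \<comment> \<open>\<open>V'\<close> is to the derivative of \<open>f / sqrt s\<close> as
    \<open>e\<close> to \<open>e - 1/2\<close>. The quotient \<open>e / (e - 1/2)\<close> decreases
    in \<open>e\<close>, and \<open>\<kappa> = \<beta> / (\<beta> - 1/2)\<close> is its largest
    value for \<open>e \<ge> \<beta>\<close>.\<close>
  define \<kappa> where "\<kappa> = 1 / (1 - 1 / (2 * \<beta>))"
  have \<kappa>: "\<kappa> > 0" "\<kappa> * (1 - 1 / (2 * \<beta>)) = 1" using \<beta> by (auto simp: \<kappa>_def field_simps)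
  have V_le: "V r \<le> V s3 + \<kappa> * (f r / sqrt r)" if "r \<ge> s3" for r
  proof -
    have "V r - \<kappa> * (f r / sqrt r) \<le> V s3 - \<kappa> * (f s3 / sqrt s3)"
    proof (rule DERIV_nonpos_imp_decreasing_open[OF that])
      fix x assume x: "s3 < x" "x < r"
      then have x1: "x > 1" by (simp add: s3_def)
      have "((\<lambda>s. V s - \<kappa> * (f s / sqrt s)) has_real_derivative
          f' x / sqrt x - \<kappa> * ((f' x * sqrt x - f x * (inverse (sqrt x) / 2)) / (sqrt x * sqrt x))) (at x)"
        using x1 by (auto intro!: derivative_eq_intros V_deriv f'_deriv simp: algebra_simps)
      moreover have "f' x / sqrt x - \<kappa> * ((f' x * sqrt x - f x * (inverse (sqrt x) / 2)) / (sqrt x * sqrt x))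
          = f x / (x * sqrt x) * (e x - \<kappa> * (e x - 1 / 2))"
        using x1 by (simp add: f'_def field_simps)
      moreover have "e x \<le> \<kappa> * (e x - 1 / 2)"
      proof -
        have "e x = \<kappa> * (1 - 1 / (2 * \<beta>)) * e x" by (simp only: \<kappa>(2) mult_1)
        also have "\<dots> = \<kappa> * (e x - e x / (2 * \<beta>))" by (simp add: algebra_simps)
        also have "\<dots> \<le> \<kappa> * (e x - 1 / 2)"
          using \<kappa>(1) \<beta> s3'[of x] x by (intro mult_left_mono) (auto simp: s3_def field_simps)
        finally show ?thesis .
      qed
      ultimately show "\<exists>y. ((\<lambda>s. V s - \<kappa> * (f s / sqrt s)) has_real_derivative y) (at x) \<and> y \<le> 0"
        using x1 pos[of x] by (intro exI conjI) (auto intro!: mult_nonneg_nonpos divide_nonpos_nonneg)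
    next
      show "continuous_on {s3..r} (\<lambda>s. V s - \<kappa> * (f s / sqrt s))"
        by (intro continuous_intros continuous_on_subset[OF V_cont] continuous_on_subset[OF f_cont])
          (auto simp: s3_def)
    qed
    moreover have "0 \<le> \<kappa> * (f s3 / sqrt s3)" using \<kappa> pos[of s3] by (simp add: s3_def)
    ultimately show ?thesis by linarith
  qed
  have Vf: "\<forall>\<^sub>F r in at_top. sqrt r * V r \<le> (\<kappa> + \<bar>V s3\<bar>) * f r"
  proof -
    have "\<forall>\<^sub>F r in at_top. 1 \<le> f r / sqrt r" using f_over_sqrt by (simp add: filterlim_at_top)
    then show ?thesis using eventually_ge_at_top[of s3]
    proof eventually_elim
      case (elim r)
      have r1: "r \<ge> 1" using elim by (simp add: s3_def)
      have "sqrt r * V r \<le> sqrt r * (V s3 + \<kappa> * (f r / sqrt r))"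
        using V_le[OF elim(2)] r1 by (intro mult_left_mono) auto
      also have "\<dots> = sqrt r * V s3 + \<kappa> * f r" using r1 by (simp add: field_simps)
      also have "sqrt r * V s3 \<le> f r * \<bar>V s3\<bar>"
      proof -
        have "sqrt r * V s3 \<le> sqrt r * \<bar>V s3\<bar>" using r1 by (intro mult_left_mono) auto
        also have "\<dots> \<le> f r * \<bar>V s3\<bar>"
          using elim(1) r1 by (intro mult_right_mono) (auto simp: field_simps)
        finally show ?thesis .
      qed
      finally show ?case by (simp add: algebra_simps)
    qed
  qed
  define \<eta> where "\<eta> = \<theta> / 10"
  have \<eta>: "0 < \<eta>" "\<eta> < 1" using \<theta> by (auto simp: \<eta>_def)
  \<comment> \<open>Since \<open>f s / s\<close> decreases for large \<open>s\<close>,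
    \<open>f (\<eta> * r)\<close> is at least \<open>\<eta> * f r\<close>, and \<open>V_ge\<close>
    at \<open>\<eta> * r\<close> carries this over to \<open>V\<close>. The 2 absorbs
    \<open>f 1\<close>.\<close>
  have fV: "\<forall>\<^sub>F r in at_top. f r \<le> 2 / \<eta> * (sqrt r * V (\<theta> * r / 10))"
  proof -
    have "\<forall>\<^sub>F r in at_top. 2 * f 1 / \<eta> \<le> f r" using f_lim by (simp add: filterlim_at_top)
    then show ?thesis
      using eventually_ge_at_top[of "max 1 s0 / \<eta>"] eventually_ge_at_top[of 1]
    proof eventually_elim
      case (elim r)
      have \<eta>r: "max 1 s0 \<le> \<eta> * r" using elim \<eta> by (simp add: field_simps)
      have lt: "\<eta> * r < r" using \<eta> elim by simp
      have "f r / r < f (\<eta> * r) / (\<eta> * r)"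
        by (rule quotient_by_argument_decreasing[OF f_cont f'_deriv pos \<theta>(1) s0]) (use \<eta>r lt in auto)
      then have f\<eta>: "\<eta> * f r \<le> f (\<eta> * r)" using elim \<eta> by (simp add: field_simps)
      have "f (\<eta> * r) - f 1 \<le> sqrt r * ((f (\<eta> * r) - f 1) / sqrt (\<eta> * r))"
      proof -
        have "0 \<le> f (\<eta> * r) - f 1"
          using strict_mono_onD[OF mono, of 1 "\<eta> * r"] \<eta>r by (cases "\<eta> * r = 1") auto
        moreover have "1 \<le> sqrt r / sqrt (\<eta> * r)" using lt \<eta>r \<eta> by simp
        ultimately show ?thesis
          using mult_right_mono[of 1 "sqrt r / sqrt (\<eta> * r)" "f (\<eta> * r) - f 1"] by simp
      qed
      also have "\<dots> \<le> sqrt r * V (\<eta> * r)"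
        using V_ge[of "\<eta> * r"] \<eta>r elim by (intro mult_left_mono) auto
      finally have "\<eta> * f r - f 1 \<le> sqrt r * V (\<eta> * r)" using f\<eta> by linarith
      moreover have "f 1 \<le> \<eta> * f r / 2" using elim(1) \<eta> by (simp add: field_simps)
      ultimately have "\<eta> * f r / 2 \<le> sqrt r * V (\<eta> * r)" by linarith
      then show ?case using \<eta> by (simp add: \<eta>_def field_simps)
    qed
  qed
  show ?thesis
  proof (rule growth_of_inverse_angle[OF f_cont f'_deriv f'_nonneg mono f_lim _ V_cont V_deriv V_lim \<theta>(1,2) \<theta>_ev])
    show "0 \<le> f 1" using pos[of 1] by simp
    show "\<exists>C>0. \<forall>\<^sub>F r in at_top. f r \<le> C * f r" by (intro exI[of _ 1]) auto
    show "\<exists>C>0. \<forall>\<^sub>F r in at_top. sqrt r * V r \<le> C * f r"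
      using Vf \<kappa> by (intro exI[of _ "\<kappa> + \<bar>V s3\<bar>"]) auto
    show "\<exists>C>0. \<forall>\<^sub>F r in at_top. f r \<le> C * (sqrt r * V (\<theta> * r / 10))"
      using fV \<eta> by (intro exI[of _ "2 / \<eta>"]) auto
  qed (use x0 g in auto)
next
  fix v
  assume sv: "smoothly_varying v (-1)"
    and V_lim: "filterlim (\<lambda>r. integral {1..r} v) at_top at_top"
    and f: "\<forall>r\<ge>1. f r = sqrt r * integral {1..r} v" and x0: "x0 = 1"
    and g: "\<forall>x\<ge>x0. g x = x / inv_into {1..} (\<lambda>r. integral {1..r} (\<lambda>s. sqrt s * v s)) x"
  obtain e where pos: "\<And>s. s \<ge> 1 \<Longrightarrow> 0 < v s" and v_cont: "continuous_on {1..} v"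
    and v_deriv: "\<And>s. s > 1 \<Longrightarrow> (v has_real_derivative v s * e s / s) (at s)"
    and e_lim: "(e \<longlongrightarrow> -1) at_top"
    using smoothly_varying_logarithmic_derivative[OF sv] by blast
  define k where "k = (\<lambda>r. integral {1..r} (\<lambda>s. sqrt s * v s))"
  \<comment> \<open>Here \<open>k' = sqrt s * v\<close>, so \<open>V' = k' / sqrt s\<close> is
    \<open>v\<close> itself and \<open>f = sqrt r * V\<close> holds exactly.\<close>
  define V where "V = (\<lambda>r. integral {1..r} v)"
  have sv_cont: "continuous_on {1..} (\<lambda>s. sqrt s * v s)" by (intro continuous_intros v_cont)
  note k_deriv = integral_from_1(1)[OF sv_cont, folded k_def]
    and k_cont = integral_from_1(2)[OF sv_cont, folded k_def]
    and V_deriv = integral_from_1(1)[OF v_cont, folded V_def]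
    and V_cont = integral_from_1(2)[OF v_cont, folded V_def]
  note V_lim = V_lim[folded V_def]
  have [simp]: "k 1 = 0" "V 1 = 0" by (simp_all add: k_def V_def)
  have k_mono: "strict_mono_on {1..} k"
  proof (rule strict_mono_onI)
    fix s s' :: real assume s: "s \<in> {1..}" "s' \<in> {1..}" "s < s'"
    show "k s < k s'"
    proof (rule DERIV_pos_imp_increasing_open[OF s(3)])
      show "\<exists>y. (k has_real_derivative y) (at x) \<and> 0 < y" if "s < x" "x < s'" for x
        using k_deriv[of x] pos[of x] s that by (intro exI[of _ "sqrt x * v x"]) auto
      show "continuous_on {s..s'} k" by (rule continuous_on_subset[OF k_cont]) (use s in auto)
    qed
  qed
  have V_nonneg: "0 \<le> V r" if "r \<ge> 1" for r
  proof -
    have "V 1 \<le> V r"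
    proof (rule DERIV_nonneg_imp_increasing_open[OF that])
      show "\<exists>y. (V has_real_derivative y) (at x) \<and> 0 \<le> y" if "1 < x" "x < r" for x
        using V_deriv[of x] pos[of x] that by (intro exI[of _ "v x"]) auto
      show "continuous_on {1..r} V" by (rule continuous_on_subset[OF V_cont]) auto
    qed
    then show ?thesis by simp
  qed
  have k_ge: "V r \<le> k r" if "r \<ge> 1" for r
  proof -
    have "k 1 - V 1 \<le> k r - V r"
    proof (rule DERIV_nonneg_imp_increasing_open[OF that])
      fix x assume x: "1 < x" "x < r"
      have "1 * v x \<le> sqrt x * v x" using x pos[of x] by (intro mult_right_mono) auto
      then show "\<exists>y. ((\<lambda>s. k s - V s) has_real_derivative y) (at x) \<and> 0 \<le> y"
        using x by (intro exI[of _ "sqrt x * v x - v x"] conjI DERIV_diff k_deriv V_deriv) auto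
    next
      show "continuous_on {1..r} (\<lambda>s. k s - V s)"
        by (intro continuous_intros continuous_on_subset[OF V_cont] continuous_on_subset[OF k_cont]) auto
    qed
    then show ?thesis by simp
  qed
  have k_lim: "filterlim k at_top at_top"
    by (rule filterlim_at_top_mono[OF V_lim]) (use k_ge in \<open>auto simp: eventually_at_top_linorder\<close>)
  \<comment> \<open>Integration by parts again: \<open>sqrt s * V - k\<close> has the derivative
    \<open>V / (2 * sqrt s)\<close>.\<close>
  have k_le: "k r \<le> f r" if "r \<ge> 1" for r
  proof -
    have "sqrt 1 * V 1 - k 1 \<le> sqrt r * V r - k r"
    proof (rule DERIV_nonneg_imp_increasing_open[OF that])
      fix x assume x: "1 < x" "x < r"
      have "((\<lambda>s. sqrt s * V s - k s) has_real_derivative inverse (sqrt x) / 2 * V x) (at x)"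
        using x by (auto intro!: derivative_eq_intros k_deriv V_deriv)
      then show "\<exists>y. ((\<lambda>s. sqrt s * V s - k s) has_real_derivative y) (at x) \<and> 0 \<le> y"
        using x V_nonneg[of x] by (intro exI[of _ "inverse (sqrt x) / 2 * V x"]) auto
    next
      show "continuous_on {1..r} (\<lambda>s. sqrt s * V s - k s)"
        by (intro continuous_intros continuous_on_subset[OF V_cont] continuous_on_subset[OF k_cont]) auto
    qed
    then show ?thesis using f that by (simp add: V_def)
  qed
  \<comment> \<open>The derivative of \<open>s^(3/2) v\<close> is
    \<open>sqrt s * v * (3/2 + e)\<close>. With \<open>e < - 3/4\<close> it is at most
    \<open>3/4 * k'\<close>, and 3/4 lies below \<open>1 / (1 + 1/4) = 4/5\<close>.\<close>
  have "\<forall>\<^sub>F s in at_top. e s < - (3 / 4)" by (rule order_tendstoD(2)[OF e_lim]) simp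
  then obtain s0' where s0': "\<And>s. s \<ge> s0' \<Longrightarrow> e s < - (3 / 4)" by (auto simp: eventually_at_top_linorder)
  define s0 where "s0 = max 1 s0'"
  have s0: "s0 \<ge> 1" "\<And>s. s \<ge> s0 \<Longrightarrow> e s < - (3 / 4)" using s0' by (auto simp: s0_def)
  have sk: "\<forall>\<^sub>F s in at_top. (1 + 1 / 4) * s * (sqrt s * v s) \<le> k s"
  proof -
    define C where "C = s0 * (sqrt s0 * v s0) - 3 / 4 * k s0"
    have le: "s * (sqrt s * v s) - 3 / 4 * k s \<le> C" if "s \<ge> s0" for s
      unfolding C_def
    proof (rule DERIV_nonpos_imp_decreasing_open[OF that])
      fix x assume x: "s0 < x" "x < s"
      then have x1: "x > 1" using s0 by simp
      have "((\<lambda>s. s * (sqrt s * v s) - 3 / 4 * k s) has_real_derivative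
          sqrt x * v x + x * (inverse (sqrt x) / 2 * v x + sqrt x * (v x * e x / x)) - 3 / 4 * (sqrt x * v x)) (at x)"
        using x1 by (auto intro!: derivative_eq_intros k_deriv v_deriv)
      moreover have "sqrt x * v x + x * (inverse (sqrt x) / 2 * v x + sqrt x * (v x * e x / x)) - 3 / 4 * (sqrt x * v x)
          = sqrt x * v x * (3 / 4 + e x)"
      proof -
        define q where "q = sqrt x"
        have q: "q > 0" "x = q * q" using x1 by (auto simp: q_def)
        show ?thesis unfolding q_def[symmetric] using q(1) by (simp add: q(2) field_simps)
      qed
      moreover have "sqrt x * v x * (3 / 4 + e x) \<le> 0"
        using x1 pos[of x] s0(2)[of x] x by (intro mult_nonneg_nonpos) auto
      ultimately show "\<exists>y. ((\<lambda>s. s * (sqrt s * v s) - 3 / 4 * k s) has_real_derivative y) (at x) \<and> y \<le> 0"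
        by metis
    next
      show "continuous_on {s0..s} (\<lambda>s. s * (sqrt s * v s) - 3 / 4 * k s)"
        using s0 by (intro continuous_intros continuous_on_subset[OF v_cont] continuous_on_subset[OF k_cont]) auto
    qed
    \<comment> \<open>The slack \<open>4/5 - 3/4 = 1/20\<close> absorbs the constant
      \<open>C\<close>.\<close>
    have "\<forall>\<^sub>F s in at_top. 20 * C \<le> k s" using k_lim by (simp add: filterlim_at_top)
    then show ?thesis using eventually_ge_at_top[of s0]
    proof eventually_elim
      case (elim s)
      show ?case using le[OF elim(2)] elim(1) by (simp add: field_simps)
    qed
  qed
  have sV: "\<forall>\<^sub>F s in at_top. s * v s \<le> V s"
  proof -
    define C where "C = s0 * v s0 - 1 / 2 * V s0"
    have le: "s * v s - 1 / 2 * V s \<le> C" if "s \<ge> s0" for s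
      unfolding C_def
    proof (rule DERIV_nonpos_imp_decreasing_open[OF that])
      fix x assume x: "s0 < x" "x < s"
      then have x1: "x > 1" using s0 by simp
      have "((\<lambda>s. s * v s - 1 / 2 * V s) has_real_derivative v x * (1 / 2 + e x)) (at x)"
        using x1 by (auto intro!: derivative_eq_intros V_deriv v_deriv simp: field_simps)
      moreover have "v x * (1 / 2 + e x) \<le> 0"
        using x1 pos[of x] s0(2)[of x] x by (intro mult_nonneg_nonpos) auto
      ultimately show "\<exists>y. ((\<lambda>s. s * v s - 1 / 2 * V s) has_real_derivative y) (at x) \<and> y \<le> 0"
        by metis
    next
      show "continuous_on {s0..s} (\<lambda>s. s * v s - 1 / 2 * V s)"
        using s0 by (intro continuous_intros continuous_on_subset[OF v_cont] continuous_on_subset[OF V_cont]) auto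
    qed
    have "\<forall>\<^sub>F s in at_top. 2 * C \<le> V s" using V_lim by (simp add: filterlim_at_top)
    then show ?thesis using eventually_ge_at_top[of s0]
    proof eventually_elim
      case (elim s)
      show ?case using le[OF elim(2)] elim(1) by simp
    qed
  qed
  \<comment> \<open>By \<open>sV\<close> the quotient \<open>V s / s\<close> is eventually
    nonincreasing, so \<open>V r\<close> is at most \<open>40 * V (r / 40)\<close>; and
    \<open>r / 40\<close> is \<open>\<theta> * r / 10\<close> for
    \<open>\<theta> = 1/4\<close>.\<close>
  have fV: "\<forall>\<^sub>F r in at_top. f r \<le> 40 * (sqrt r * V (1 / 4 * r / 10))"
  proof -
    obtain s4' where s4': "\<And>s. s \<ge> s4' \<Longrightarrow> s * v s \<le> V s" using sV by (auto simp: eventually_at_top_linorder)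
    define s4 where "s4 = max 1 s4'"
    show ?thesis using eventually_ge_at_top[of "40 * s4"]
    proof eventually_elim
      case (elim r)
      define t where "t = r / 40"
      have t: "s4 \<le> t" "1 \<le> t" "t \<le> r" "r = 40 * t" using elim by (auto simp: t_def s4_def)
      have "V r / r \<le> V t / t"
      proof (rule DERIV_nonpos_imp_decreasing_open[OF t(3)])
        fix x assume x: "t < x" "x < r"
        have "((\<lambda>s. V s / s) has_real_derivative (v x * x - V x) / (x * x)) (at x)"
          using x t by (auto intro!: derivative_eq_intros V_deriv)
        moreover have "(v x * x - V x) / (x * x) \<le> 0"
          using s4'[of x] x t by (intro divide_nonpos_nonneg) (auto simp: s4_def mult.commute)
        ultimately show "\<exists>y. ((\<lambda>s. V s / s) has_real_derivative y) (at x) \<and> y \<le> 0" by blast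
      next
        show "continuous_on {t..r} (\<lambda>s. V s / s)"
          using t by (intro continuous_intros continuous_on_subset[OF V_cont]) auto
      qed
      then have "V r \<le> 40 * V t" using t by (simp add: field_simps)
      then have "sqrt r * V r \<le> sqrt r * (40 * V t)" using t by (intro mult_left_mono) auto
      moreover have "f r = sqrt r * V r" using f t by (simp add: V_def)
      moreover have "1 / 4 * r / 10 = t" by (simp add: t_def)
      ultimately show ?case by simp
    qed
  qed
  show ?thesis
  proof (rule growth_of_inverse_angle[where k = k and k' = "\<lambda>s. sqrt s * v s" and V = V and \<theta> = "1 / 4"])
    show "(V has_real_derivative sqrt s * v s / sqrt s) (at s)" if "s > 1" for s
      using V_deriv[OF that] that by simp
    show "0 \<le> sqrt s * v s" if "s > 1" for s using pos[of s] that by simp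
    show "\<exists>C>0. \<forall>\<^sub>F r in at_top. k r \<le> C * f r"
    proof (intro exI[of _ 1] conjI)
      show "\<forall>\<^sub>F r in at_top. k r \<le> 1 * f r"
        using eventually_ge_at_top[of 1] by eventually_elim (use k_le in simp)
    qed simp
    show "\<exists>C>0. \<forall>\<^sub>F r in at_top. sqrt r * V r \<le> C * f r"
    proof (intro exI[of _ 1] conjI)
      show "\<forall>\<^sub>F r in at_top. sqrt r * V r \<le> 1 * f r"
        using eventually_ge_at_top[of 1] by eventually_elim (use f in \<open>simp add: V_def\<close>)
    qed simp
    show "\<exists>C>0. \<forall>\<^sub>F r in at_top. f r \<le> C * (sqrt r * V (1 / 4 * r / 10))"
      using fV by (intro exI[of _ 40]) auto
    show "g x = x / inv_into {1..} k x" if "x \<ge> x0" for x using g that by (simp add: k_def)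
    show "(k has_real_derivative sqrt s * v s) (at s)" if "s > 1" for s by (rule k_deriv[OF that])
    show "\<forall>\<^sub>F s in at_top. (1 + 1 / 4) * s * (sqrt s * v s) \<le> k s" by (rule sk)
    show "k 1 \<le> x0" by (simp add: x0)
  qed (simp_all add: k_cont V_cont V_lim k_mono k_lim)
qed

end
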